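(* Let $n,k$ be positive integers with $n>36k$ and let $\mathcal F\subset\binom{[n]}{k}$ be an intersecting family. Then \[ \gamma(\mathcal F)\le \binom{n-3}{k-2}. \]
   Context: $[n]=\{1,\dots,n\}$ and $\binom{[n]}{k}$ is the set of $k$-element subsets of $[n]$. A family $\mathcal F$ is intersecting if $F\cap F'\neq\emptyset$ for all $F,F'\in\mathcal F$. For $i\in[n]$ let $\mathcal F(\bar i)=\{F\in\mathcal F: i\notin F\}$. The diversity of $\mathcal F$ is $\gamma(\mathcal F)=\min_{i\in[n]}|\mathcal F(\bar i)|$, i.e. the minimum number of sets whose deletion leaves a family with nonempty common intersection. Binomial coefficients $\binom{m}{j}$ are $0$ when $j<0$ or $j>m$. *)

theory Defs
  imports Main
begin

definition k_subsets :: "nat \<Rightarrow> nat \<Rightarrow> nat set set" where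
  "k_subsets n k = {A. A \<subseteq> {1..n} \<and> card A = k}"

definition intersecting :: "'a set set \<Rightarrow> bool" where
  "intersecting \<F> \<longleftrightarrow> (\<forall>F\<in>\<F>. \<forall>F'\<in>\<F>. F \<inter> F' \<noteq> {})"

definition avoiding :: "'a set set \<Rightarrow> 'a \<Rightarrow> 'a set set" where
  "avoiding \<F> i = {F \<in> \<F>. i \<notin> F}"

definition diversity :: "nat \<Rightarrow> nat set set \<Rightarrow> nat" where
  "diversity n \<F> = (MIN i\<in>{1..n}. card (avoiding \<F> i))"

text \<open>Integer arguments, because for \<open>k = 1\<close> the truncated difference \<open>k - 2\<close> on the
  naturals would turn a vanishing binomial coefficient into \<open>1\<close>.\<close>

definition int_binom :: "int \<Rightarrow> int \<Rightarrow> nat" where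
  "int_binom m j = (if j < 0 \<or> j > m then 0 else nat m choose nat j)"

end

theory Submission
  imports Defs Complex_Main
begin

text \<open>
  Write \<open>M = binom(n-3,k-3)\<close> and \<open>N = binom(n-3,k-2)\<close>, so that \<open>N \<ge> 35 M\<close>.

  The heart of the matter is that an intersecting family \<open>\<F>\<close> with at least \<open>35 M\<close> members has an element lying in
  more than half of them. Suppose not, and shift \<open>\<F>\<close> as long as all degrees stay at most \<open>|\<F>|/2\<close>. A fully shifted
  intersecting family has its first element in more than half of its members, so at some moment shifting \<open>y\<close> to \<open>x\<close>
  is forbidden, that is, more than half of the members hit \<open>{x,y}\<close>; outside \<open>{x,y}\<close> one either can shift completely or
  finds a second such pair. Lattice path counting for shifted cross-intersecting families shows that more than \<open>2.2 M\<close>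
  members through a pair leave at most \<open>1.2 M\<close> members avoiding it; hence no pair is contained in more than \<open>2.2 M\<close>
  members, which is too few for the hitting pairs.

  If now every element is avoided by more than \<open>N\<close> members, two applications of this degree bound produce a
  triangle \<open>x, y, z\<close> such that all but \<open>O(M)\<close> members contain at least two of its vertices, and all but \<open>O(M)\<close> of the
  \<open>k\<close>-sets containing exactly two given vertices belong to \<open>\<F>\<close>. By the spectral gap of the disjointness matrix each
  member containing at most one vertex is paid for by many missing sets with exactly two vertices, so some vertex is
  avoided by at most \<open>N\<close> members after all.
\<close>

subsection \<open>Shifting\<close>

text \<open>Shifting can raise a degree and so lower the diversity. Hence only a degree statement is
  proved by shifting, by contradiction, and the shift that has to be refused is the source of
  information.

  All constants come from one comparison. Fixing a further element divides the number of sets by at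
  least 36, while the binomials that count prefixes are bounded by multiples of 4 to the
  \<open>j\<close>. So each sum is little more than its leading part, 2, 1 or 1 times a binomial at
  most \<open>M\<close>; the corrections give 2.2, 1.2 and 1.02. The tightest budget is that of two
  hitting pairs: seven pairs and two single traces, 7 * 2.2 + 2 * 1.02 = 17.44, against half of 35.

  The triangle arises by applying the degree bound to a union of equally many members through
  \<open>x\<close> only and through \<open>y\<close> only. There \<open>x\<close> and
  \<open>y\<close> have exactly half of the members, so a third element \<open>z\<close> has more.
  For k >= 2 the bound is attained by all \<open>k\<close>-sets containing at least two of three
  fixed elements.\<close>

definition subsets_of_size :: "nat set \<Rightarrow> nat \<Rightarrow> nat set set" where
  "subsets_of_size X k = {A. A \<subseteq> X \<and> card A = k}"

text \<open>Real valued and a sum of indicators: identities and covers can then be checked member by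
  member, and counts combine linearly with fractional multiples of \<open>M\<close>.\<close>

definition cnt :: "nat set set \<Rightarrow> (nat set \<Rightarrow> bool) \<Rightarrow> real" where
  "cnt \<F> P = (\<Sum>F\<in>\<F>. of_bool (P F))"

text \<open>The compression of Erdos, Ko and Rado, moving \<open>j\<close> to \<open>i\<close>. A
  set stays if its image is already a member, which keeps the map injective.\<close>

definition shift :: "nat \<Rightarrow> nat \<Rightarrow> nat set set \<Rightarrow> nat set set" where
  "shift i j \<F> = (\<lambda>F. if j \<in> F \<and> i \<notin> F \<and> insert i (F - {j}) \<notin> \<F> then insert i (F - {j}) else F) ` \<F>"

definition shifted_on :: "nat set \<Rightarrow> nat set set \<Rightarrow> bool" where
  "shifted_on V \<F> \<longleftrightarrow> (\<forall>F\<in>\<F>. \<forall>i\<in>V. \<forall>j\<in>V. i < j \<and> j \<in> F \<and> i \<notin> F \<longrightarrow> insert i (F - {j}) \<in> \<F>)"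

definition cross :: "nat \<Rightarrow> nat set set \<Rightarrow> nat set set \<Rightarrow> bool" where
  "cross t \<A> \<B> \<longleftrightarrow> (\<forall>A\<in>\<A>. \<forall>B\<in>\<B>. t \<le> card (A \<inter> B))"

lemma finite_subsets_of_size: "finite X \<Longrightarrow> finite (subsets_of_size X k)"
  unfolding subsets_of_size_def by (rule finite_subset[of _ "Pow X"]) auto

lemma card_subsets_of_size: "finite X \<Longrightarrow> card (subsets_of_size X k) = card X choose k"
  unfolding subsets_of_size_def by (rule n_subsets)

lemma cnt_eq_card: "finite \<F> \<Longrightarrow> cnt \<F> P = real (card {F\<in>\<F>. P F})"
  unfolding cnt_def by (simp add: of_bool_def sum.If_cases Int_def)

lemma cnt_nonneg: "cnt \<F> P \<ge> 0"
  unfolding cnt_def by (simp add: sum_nonneg)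

lemma inj_on_shift_map:
  "inj_on (\<lambda>F. if j \<in> F \<and> i \<notin> F \<and> insert i (F - {j}) \<notin> \<F> then insert i (F - {j}) else F) \<F>"
proof (rule inj_onI)
  fix F G
  let ?s = "\<lambda>F. if j \<in> F \<and> i \<notin> F \<and> insert i (F - {j}) \<notin> \<F> then insert i (F - {j}) else F"
  assume F: "F \<in> \<F>" and G: "G \<in> \<F>" and eq: "?s F = ?s G"
  show "F = G"
  proof (cases "(j \<in> F \<and> i \<notin> F \<and> insert i (F - {j}) \<notin> \<F>) \<and> (j \<in> G \<and> i \<notin> G \<and> insert i (G - {j}) \<notin> \<F>)")
    case True
    then have e: "insert i (F - {j}) = insert i (G - {j})" using eq by simp
    have "F = insert j (insert i (F - {j}) - {i})" using True by auto
    also have "\<dots> = insert j (insert i (G - {j}) - {i})" using e by simp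
    also have "\<dots> = G" using True by auto
    finally show ?thesis .
  next
    case False
    then show ?thesis using eq F G by (auto split: if_splits)
  qed
qed

text \<open>The quantities controlled during shifting are of this kind: traces on a set disjoint
  from \<open>{i, j}\<close>, or properties symmetric in \<open>i\<close> and \<open>j\<close>, such
  as hitting \<open>{i, j}\<close>.\<close>

lemma cnt_shift:
  assumes "\<And>F. j \<in> F \<Longrightarrow> i \<notin> F \<Longrightarrow> P (insert i (F - {j})) = P F"
  shows "cnt (shift i j \<F>) P = cnt \<F> P"
  unfolding cnt_def shift_def
  by (subst sum.reindex[OF inj_on_shift_map]) (auto intro!: sum.cong simp: assms)

lemma card_shift: "card (shift i j \<F>) = card \<F>"
  unfolding shift_def by (rule card_image[OF inj_on_shift_map])

lemma mem_shiftE: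
  assumes "F \<in> shift i j \<F>"
  obtains (old) "F \<in> \<F>" "j \<notin> F \<or> i \<in> F \<or> insert i (F - {j}) \<in> \<F>"
  | (new) G where "G \<in> \<F>" "j \<in> G" "i \<notin> G" "insert i (G - {j}) \<notin> \<F>" "F = insert i (G - {j})"
  using assms unfolding shift_def by (auto split: if_splits)

lemma shift_subset:
  assumes "\<F> \<subseteq> subsets_of_size X k" "i \<in> X" "finite X"
  shows "shift i j \<F> \<subseteq> subsets_of_size X k"
proof
  fix F assume "F \<in> shift i j \<F>"
  then show "F \<in> subsets_of_size X k"
  proof (cases rule: mem_shiftE)
    case old then show ?thesis using assms by auto
  next
    case (new G)
    then have G: "G \<subseteq> X" "card G = k" "finite G"
      using assms by (auto simp: subsets_of_size_def intro: finite_subset[of G X])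
    have "card (insert i (G - {j})) = k"
      using G new by (metis Diff_iff card.insert_remove card_insert_disjoint card_Suc_Diff1 finite_Diff insert_Diff_single)
    then show ?thesis using G new assms by (auto simp: subsets_of_size_def)
  qed
qed

lemma intersecting_shift:
  assumes "intersecting \<F>" "i \<noteq> j"
  shows "intersecting (shift i j \<F>)"
proof -
  have int: "F \<inter> G \<noteq> {}" if "F \<in> \<F>" "G \<in> \<F>" for F G
    using assms that by (auto simp: intersecting_def)
  have mixed: "F \<inter> insert i (G - {j}) \<noteq> {}"
    if F: "F \<in> \<F>" "j \<notin> F \<or> i \<in> F \<or> insert i (F - {j}) \<in> \<F>"
      and G: "G \<in> \<F>" "j \<in> G" "i \<notin> G" for F G
  proof (cases "i \<in> F")
    case False
    show ?thesis
    proof (cases "j \<in> F")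
      \<comment> \<open>\<open>F\<close> stayed although it could move, so its image is a member.
        What this image shares with \<open>G\<close> is neither \<open>i\<close> nor
        \<open>j\<close>, hence lies in \<open>F\<close> and in the image of
        \<open>G\<close>.\<close>
      case True
      then have "insert i (F - {j}) \<in> \<F>" using F False by auto
      from int[OF this G(1)] show ?thesis using G False by auto
    next
      case False
      then show ?thesis using int[OF F(1) G(1)] by auto
    qed
  qed auto
  show ?thesis
    unfolding intersecting_def
  proof (intro ballI)
    fix F G assume F: "F \<in> shift i j \<F>" and G: "G \<in> shift i j \<F>"
    from F show "F \<inter> G \<noteq> {}"
    proof (cases rule: mem_shiftE)
      case old1: old
      from G show ?thesis
      proof (cases rule: mem_shiftE)
        case old then show ?thesis using int old1 by auto
      next
        case (new G') then show ?thesis using mixed[of F G'] old1 by auto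
      qed
    next
      case new1: (new F')
      from G show ?thesis
      proof (cases rule: mem_shiftE)
        case old then show ?thesis using mixed[of G F'] new1 by auto
      next
        case (new G') then show ?thesis using new1 by auto
      qed
    qed
  qed
qed

lemma sum_shift_less:
  assumes fin: "finite \<F>" "\<And>F. F \<in> \<F> \<Longrightarrow> finite F" and "i < j" and ne: "shift i j \<F> \<noteq> \<F>"
  shows "(\<Sum>F\<in>shift i j \<F>. \<Sum>F) < (\<Sum>F\<in>\<F>. \<Sum>F)"
proof -
  let ?s = "\<lambda>F. if j \<in> F \<and> i \<notin> F \<and> insert i (F - {j}) \<notin> \<F> then insert i (F - {j}) else F"
  have dec: "\<Sum>(insert i (F - {j})) < \<Sum>F" if "F \<in> \<F>" "j \<in> F" "i \<notin> F" for F
  proof -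
    have "\<Sum>(insert i (F - {j})) = i + \<Sum>(F - {j})" using that fin by auto
    moreover have "\<Sum>F = j + \<Sum>(F - {j})" using that fin by (auto simp: sum.remove)
    ultimately show ?thesis using \<open>i < j\<close> by simp
  qed
  have "\<exists>F\<in>\<F>. ?s F \<noteq> F"
  proof (rule ccontr)
    assume "\<not> ?thesis"
    then have "?s ` \<F> = (\<lambda>F. F) ` \<F>" by (intro image_cong) auto
    then show False using ne unfolding shift_def by simp
  qed
  then obtain F0 where F0: "F0 \<in> \<F>" "?s F0 \<noteq> F0" by blast
  have "(\<Sum>F\<in>\<F>. \<Sum>(?s F)) < (\<Sum>F\<in>\<F>. \<Sum>F)"
  proof (rule sum_strict_mono_ex1[OF fin(1)])
    show "\<forall>F\<in>\<F>. \<Sum>(?s F) \<le> \<Sum>F" using dec by (auto simp: less_imp_le)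
    show "\<exists>F\<in>\<F>. \<Sum>(?s F) < \<Sum>F" using F0 dec[of F0] by (intro bexI[of _ F0]) (auto split: if_splits)
  qed
  then show ?thesis unfolding shift_def by (simp add: sum.reindex[OF inj_on_shift_map] del: if_image_distrib)
qed

lemma shifted_onI:
  assumes "\<And>i j. i \<in> V \<Longrightarrow> j \<in> V \<Longrightarrow> i < j \<Longrightarrow> shift i j \<F> = \<F>"
  shows "shifted_on V \<F>"
  unfolding shifted_on_def
proof (intro ballI impI)
  fix F i j assume F: "F \<in> \<F>" and ij: "i \<in> V" "j \<in> V" and *: "i < j \<and> j \<in> F \<and> i \<notin> F"
  show "insert i (F - {j}) \<in> \<F>"
  proof (rule ccontr)
    assume "insert i (F - {j}) \<notin> \<F>"
    then have "insert i (F - {j}) \<in> shift i j \<F>" using F * unfolding shift_def by (auto intro!: image_eqI[of _ _ F])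
    then show False using assms[OF ij] * \<open>insert i (F - {j}) \<notin> \<F>\<close> by simp
  qed
qed

text \<open>A shift to a smaller element that changes the family lowers the sum of all its elements.
  A family with \<open>Q\<close> minimising this sum is therefore stable under all shifts in
  \<open>V\<close>, unless one of them breaks \<open>Q\<close>.\<close>

lemma shift_ad_extremis:
  assumes "Q \<F>" and fin: "\<And>\<G>. Q \<G> \<Longrightarrow> finite \<G> \<and> (\<forall>F\<in>\<G>. finite F)"
  obtains \<G> where "Q \<G>" "shifted_on V \<G>"
  | \<G> i j where "Q \<G>" "i \<in> V" "j \<in> V" "i < j" "\<not> Q (shift i j \<G>)"
proof -
  obtain \<G> where Q: "Q \<G>" and min: "\<And>\<H>. Q \<H> \<Longrightarrow> (\<Sum>F\<in>\<G>. \<Sum>F) \<le> (\<Sum>F\<in>\<H>. \<Sum>F)"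
    using ex_has_least_nat[of Q \<F> "\<lambda>\<G>. \<Sum>F\<in>\<G>. \<Sum>F"] assms(1) by blast
  show ?thesis
  proof (cases "\<forall>i\<in>V. \<forall>j\<in>V. i < j \<longrightarrow> Q (shift i j \<G>)")
    case True
    have "shifted_on V \<G>"
    proof (rule shifted_onI)
      fix i j assume ij: "i \<in> V" "j \<in> V" "i < j"
      then have "Q (shift i j \<G>)" using True by blast
      from min[OF this] sum_shift_less[of \<G> i j] show "shift i j \<G> = \<G>"
        using fin[OF Q] ij by (meson linorder_not_le)
    qed
    then show ?thesis using that Q by blast
  next
    case False
    then show ?thesis using that Q by blast
  qed
qed

subsection \<open>Initial segments and lattice paths\<close>

text \<open>The \<open>l\<close> smallest elements of \<open>V\<close> (all of \<open>V\<close> if there are fewer).\<close>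

definition pre :: "nat set \<Rightarrow> nat \<Rightarrow> nat set" where
  "pre V l = {v \<in> V. card {w \<in> V. w < v} < l}"

lemma pre_subset: "pre V l \<subseteq> V"
  by (auto simp: pre_def)

lemma pre_mono: "l \<le> l' \<Longrightarrow> pre V l \<subseteq> pre V l'"
  by (auto simp: pre_def)

lemma inj_on_rank:
  fixes V :: "nat set"
  assumes "finite V"
  shows "inj_on (\<lambda>v. card {w \<in> V. w < v}) V"
proof -
  have lt: "card {w \<in> V. w < u} < card {w \<in> V. w < v}" if "u \<in> V" "u < v" for u v
  proof (rule psubset_card_mono)
    show "{w \<in> V. w < u} \<subset> {w \<in> V. w < v}" using that by (auto simp: psubset_eq set_eq_iff)
  qed (use assms in simp)
  show ?thesis
  proof (rule inj_onI)
    fix u v assume "u \<in> V" "v \<in> V" "card {w \<in> V. w < u} = card {w \<in> V. w < v}"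
    then show "u = v" using lt[of u v] lt[of v u] by (metis less_irrefl linorder_neqE)
  qed
qed

lemma card_pre_le:
  assumes "finite V"
  shows "card (pre V l) \<le> l"
proof -
  have "card ((\<lambda>v. card {w \<in> V. w < v}) ` pre V l) = card (pre V l)"
    by (rule card_image) (rule inj_on_subset[OF inj_on_rank[OF assms] pre_subset])
  moreover have "(\<lambda>v. card {w \<in> V. w < v}) ` pre V l \<subseteq> {..<l}" by (auto simp: pre_def)
  ultimately show ?thesis by (metis card_lessThan card_mono finite_lessThan)
qed

lemma card_Int_pre_Suc_le:
  assumes "finite V"
  shows "card (A \<inter> pre V (Suc l)) \<le> card (A \<inter> pre V l) + 1"
proof -
  let ?D = "A \<inter> pre V (Suc l) - A \<inter> pre V l"
  have fin: "finite (pre V l')" for l' using assms pre_subset finite_subset by blast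
  have "card ?D \<le> card {l}"
  proof (rule card_inj_on_le)
    show "inj_on (\<lambda>v. card {w \<in> V. w < v}) ?D"
      by (rule inj_on_subset[OF inj_on_rank[OF assms]]) (auto simp: pre_def)
  qed (auto simp: pre_def)
  moreover have "A \<inter> pre V (Suc l) = ?D \<union> A \<inter> pre V l" using pre_mono[of l "Suc l" V] by auto
  then have "card (A \<inter> pre V (Suc l)) \<le> card ?D + card (A \<inter> pre V l)"
    using card_Un_le[of ?D "A \<inter> pre V l"] by metis
  ultimately show ?thesis by simp
qed

lemma seg_eq_pre:
  assumes "finite V" "c \<in> V"
  shows "{v \<in> V. v \<le> c} = pre V (card {v \<in> V. v \<le> c})"
proof -
  have r: "card {w \<in> V. w < v} < card {w \<in> V. w \<le> c} \<longleftrightarrow> v \<le> c" if "v \<in> V" for v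
  proof
    assume "v \<le> c"
    then have "{w \<in> V. w < v} \<subset> {w \<in> V. w \<le> c}" using that by auto
    then show "card {w \<in> V. w < v} < card {w \<in> V. w \<le> c}" using assms by (simp add: psubset_card_mono)
  next
    assume l: "card {w \<in> V. w < v} < card {w \<in> V. w \<le> c}"
    show "v \<le> c"
    proof (rule ccontr)
      assume "\<not> v \<le> c"
      then have "{w \<in> V. w \<le> c} \<subseteq> {w \<in> V. w < v}" by auto
      from card_mono[OF _ this] l assms show False by simp
    qed
  qed
  show ?thesis using r by (auto simp: pre_def)
qed

text \<open>The \<open>i\<close>-th common element of \<open>A\<close> and \<open>B\<close>, \<open>i \<ge> t\<close>, has at least \<open>i - t + 1\<close> free positions below it;
  moving the \<open>t\<close>-th one into a free position preserves this Hall-type condition.\<close>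

lemma shifted_reduce_intersection:
  assumes V: "finite V" and A: "A \<subseteq> V" and sh: "shifted_on V \<B>" and t: "t \<ge> 1"
  shows "B \<in> \<B> \<Longrightarrow> B \<subseteq> V \<Longrightarrow>
     (\<And>c. c \<in> A \<inter> B \<Longrightarrow> card {d \<in> A \<inter> B. d \<le> c} + 1 \<le> card {v \<in> V. v < c \<and> v \<notin> A \<union> B} + t) \<Longrightarrow>
     \<exists>B'\<in>\<B>. B' \<subseteq> V \<and> card (A \<inter> B') < t"
proof (induction "card (A \<inter> B)" arbitrary: B rule: less_induct)
  case less
  show ?case
  proof (cases "card (A \<inter> B) < t")
    case True then show ?thesis using less.prems by blast
  next
    case False
    have finAB: "finite (A \<inter> B)" using A V finite_subset by blast
    have "\<exists>c\<in>A \<inter> B. card {d \<in> A \<inter> B. d \<le> c} = t"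
    proof -
      have "\<exists>S. S \<subseteq> A \<inter> B \<and> card S = t \<and> (\<forall>s\<in>S. \<forall>d\<in>A \<inter> B. d \<le> s \<longrightarrow> d \<in> S)"
      proof -
        have "pre (A \<inter> B) t \<subseteq> A \<inter> B" by (rule pre_subset)
        moreover have "card (pre (A \<inter> B) t) = t"
        proof -
          have rk: "(\<lambda>v. card {w \<in> A \<inter> B. w < v}) ` (A \<inter> B) = {..<card (A \<inter> B)}"
          proof (rule card_subset_eq)
            show "(\<lambda>v. card {w \<in> A \<inter> B. w < v}) ` (A \<inter> B) \<subseteq> {..<card (A \<inter> B)}"
              using finAB by (auto intro!: psubset_card_mono)
            show "card ((\<lambda>v. card {w \<in> A \<inter> B. w < v}) ` (A \<inter> B)) = card {..<card (A \<inter> B)}"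
              using card_image[OF inj_on_rank[OF finAB]] by simp
          qed simp
          have "(\<lambda>v. card {w \<in> A \<inter> B. w < v}) ` pre (A \<inter> B) t = {..<t}"
          proof
            show "{..<t} \<subseteq> (\<lambda>v. card {w \<in> A \<inter> B. w < v}) ` pre (A \<inter> B) t"
            proof
              fix i assume i: "i \<in> {..<t}"
              then have "i \<in> (\<lambda>v. card {w \<in> A \<inter> B. w < v}) ` (A \<inter> B)" unfolding rk using False by auto
              then show "i \<in> (\<lambda>v. card {w \<in> A \<inter> B. w < v}) ` pre (A \<inter> B) t" using i by (auto simp: pre_def)
            qed
          qed (auto simp: pre_def)
          then show ?thesis
            using card_image[OF inj_on_subset[OF inj_on_rank[OF finAB] pre_subset], of t] by simp
        qed
        moreover have "\<forall>s\<in>pre (A \<inter> B) t. \<forall>d\<in>A \<inter> B. d \<le> s \<longrightarrow> d \<in> pre (A \<inter> B) t"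
        proof (intro ballI impI)
          fix s d assume s: "s \<in> pre (A \<inter> B) t" and d: "d \<in> A \<inter> B" "d \<le> s"
          have "card {w \<in> A \<inter> B. w < d} \<le> card {w \<in> A \<inter> B. w < s}"
            using d finAB by (intro card_mono) auto
          then show "d \<in> pre (A \<inter> B) t" using s d by (auto simp: pre_def)
        qed
        ultimately show ?thesis by blast
      qed
      then obtain S where S: "S \<subseteq> A \<inter> B" "card S = t" "\<forall>s\<in>S. \<forall>d\<in>A \<inter> B. d \<le> s \<longrightarrow> d \<in> S" by blast
      have "finite S" using finite_subset[OF S(1) finAB] .
      moreover have "S \<noteq> {}" using S(2) t by auto
      ultimately have "Max S \<in> S" "\<forall>s\<in>S. s \<le> Max S" by auto
      then have "{d \<in> A \<inter> B. d \<le> Max S} = S" using S by blast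
      then show ?thesis using \<open>Max S \<in> S\<close> S(1,2) by (intro bexI[of _ "Max S"]) auto
    qed
    then obtain c where c: "c \<in> A" "c \<in> B" "card {d \<in> A \<inter> B. d \<le> c} = t" by blast
    have "card {v \<in> V. v < c \<and> v \<notin> A \<union> B} \<ge> 1" using less.prems(3)[of c] c by simp
    then have "{v \<in> V. v < c \<and> v \<notin> A \<union> B} \<noteq> {}" by (metis card.empty not_one_le_zero)
    then obtain v where v: "v \<in> V" "v < c" "v \<notin> A" "v \<notin> B" by blast
    let ?B = "insert v (B - {c})"
    have "c \<in> V" using c A by auto
    then have B': "?B \<in> \<B>" using sh less.prems(1) v c unfolding shifted_on_def by blast
    have AB: "A \<inter> ?B = A \<inter> B - {c}" using v by auto
    have lt: "card (A \<inter> ?B) < card (A \<inter> B)" unfolding AB using c finAB by (intro psubset_card_mono) auto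
    show ?thesis
    proof (rule less.hyps[OF lt B'])
      show "?B \<subseteq> V" using less.prems v by auto
      fix d assume d: "d \<in> A \<inter> ?B"
      then have dAB: "d \<in> A \<inter> B" "d \<noteq> c" unfolding AB by auto
      show "card {e \<in> A \<inter> ?B. e \<le> d} + 1 \<le> card {w \<in> V. w < d \<and> w \<notin> A \<union> ?B} + t"
      proof (cases "c \<le> d")
        case True
        have 1: "{e \<in> A \<inter> ?B. e \<le> d} = {e \<in> A \<inter> B. e \<le> d} - {c}" unfolding AB by auto
        have 2: "c \<in> {e \<in> A \<inter> B. e \<le> d}" using True c by auto
        have 3: "card {e \<in> A \<inter> B. e \<le> d} = card {e \<in> A \<inter> ?B. e \<le> d} + 1"
          unfolding 1 using card_Suc_Diff1[OF _ 2] finAB by simp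
        have 4: "{w \<in> V. w < d \<and> w \<notin> A \<union> ?B} = {w \<in> V. w < d \<and> w \<notin> A \<union> B} - {v}" using c by auto
        have 5: "v \<in> {w \<in> V. w < d \<and> w \<notin> A \<union> B}" using v True by auto
        have "card {w \<in> V. w < d \<and> w \<notin> A \<union> B} = card {w \<in> V. w < d \<and> w \<notin> A \<union> ?B} + 1"
          unfolding 4 using card_Suc_Diff1[OF _ 5] V by simp
        then show ?thesis using less.prems(3)[OF dAB(1)] 3 by simp
      next
        case False
        \<comment> \<open>Before \<open>c\<close> there are fewer than \<open>t\<close> common
          elements, so the condition holds without any free position.\<close>
        have "{e \<in> A \<inter> ?B. e \<le> d} \<subset> {e \<in> A \<inter> B. e \<le> c}" unfolding AB using False c by auto
        then have "card {e \<in> A \<inter> ?B. e \<le> d} < card {e \<in> A \<inter> B. e \<le> c}"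
          using finAB by (intro psubset_card_mono) auto
        then have "card {e \<in> A \<inter> ?B. e \<le> d} < t" using c(3) by simp
        then show ?thesis by simp
      qed
    qed
  qed
qed

text \<open>If no prefix were so crowded, inclusion-exclusion on the segment up to each common
  element would provide the free positions that \<open>shifted_reduce_intersection\<close> asks for,
  and \<open>B\<close> could be shifted to a member meeting \<open>A\<close> in fewer than
  \<open>t\<close> elements.\<close>

lemma cross_shifted_prefix:
  assumes V: "finite V" and sh: "shifted_on V \<B>" and t: "t \<ge> 1" and cr: "cross t \<A> \<B>"
    and A: "A \<in> \<A>" "A \<subseteq> V" and B: "B \<in> \<B>" "B \<subseteq> V"
  shows "\<exists>l\<ge>1. l + t \<le> card (A \<inter> pre V l) + card (B \<inter> pre V l)"
proof (rule ccontr)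
  assume no: "\<not> ?thesis"
  have "\<exists>B'\<in>\<B>. B' \<subseteq> V \<and> card (A \<inter> B') < t"
  proof (rule shifted_reduce_intersection[OF V A(2) sh t B])
    fix c assume c: "c \<in> A \<inter> B"
    let ?P = "{v \<in> V. v \<le> c}"
    have fin: "finite ?P" using V by simp
    have P: "?P = pre V (card ?P)" by (rule seg_eq_pre[OF V]) (use c A in auto)
    have "c \<in> ?P" using c A by auto
    then have "card ?P \<ge> 1" using fin by (metis One_nat_def Suc_leI card_gt_0_iff empty_iff)
    then have "\<not> card ?P + t \<le> card (A \<inter> pre V (card ?P)) + card (B \<inter> pre V (card ?P))" using no by blast
    then have 1: "card (A \<inter> ?P) + card (B \<inter> ?P) < card ?P + t" unfolding P[symmetric] not_le .
    have 2: "card (A \<inter> ?P) + card (B \<inter> ?P) = card ((A \<union> B) \<inter> ?P) + card (A \<inter> B \<inter> ?P)"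
      using card_Un_Int[of "A \<inter> ?P" "B \<inter> ?P"] fin by (simp add: Int_Un_distrib2 Int_ac)
    have 3: "card ?P = card ((A \<union> B) \<inter> ?P) + card (?P - (A \<union> B))"
      using card_Int_Diff[OF fin, of "A \<union> B"] by (simp add: Int_commute)
    have 4: "?P - (A \<union> B) = {v \<in> V. v < c \<and> v \<notin> A \<union> B}" using c by (auto simp: le_less)
    have 5: "A \<inter> B \<inter> ?P = {d \<in> A \<inter> B. d \<le> c}" using A by auto
    show "card {d \<in> A \<inter> B. d \<le> c} + 1 \<le> card {v \<in> V. v < c \<and> v \<notin> A \<union> B} + t"
      using 1 2 3 unfolding 4 5 by linarith
  qed
  then show False using cr A unfolding cross_def by (meson not_le)
qed

section \<open>Sets with many elements in an initial segment\<close>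

lemma card_supersets:
  assumes "finite V" "J \<subseteq> V" "card J = j" "j \<le> b"
  shows "card {B. B \<subseteq> V \<and> card B = b \<and> J \<subseteq> B} = (card V - j choose (b - j))"
proof -
  have fJ: "finite J" using assms finite_subset by blast
  have "bij_betw (\<lambda>B. B - J) {B. B \<subseteq> V \<and> card B = b \<and> J \<subseteq> B} {C. C \<subseteq> V - J \<and> card C = b - j}"
  proof (rule bij_betw_byWitness[of _ "\<lambda>C. C \<union> J"])
    show "(\<lambda>B. B - J) ` {B. B \<subseteq> V \<and> card B = b \<and> J \<subseteq> B} \<subseteq> {C. C \<subseteq> V - J \<and> card C = b - j}"
      using assms fJ by (auto simp: card_Diff_subset)
    show "(\<lambda>C. C \<union> J) ` {C. C \<subseteq> V - J \<and> card C = b - j} \<subseteq> {B. B \<subseteq> V \<and> card B = b \<and> J \<subseteq> B}"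
    proof (clarsimp, intro conjI)
      fix C assume C: "C \<subseteq> V - J" "card C = b - j"
      then have "finite C" using assms finite_subset by blast
      then show "card (C \<union> J) = b" using C fJ assms by (subst card_Un_disjoint) auto
    qed (use assms in auto)
  qed auto
  then have "card {B. B \<subseteq> V \<and> card B = b \<and> J \<subseteq> B} = card {C. C \<subseteq> V - J \<and> card C = b - j}"
    by (rule bij_betw_same_card)
  also have "\<dots> = (card V - j choose (b - j))"
    using assms fJ by (subst n_subsets) (auto simp: card_Diff_subset)
  finally show ?thesis .
qed

text \<open>The number of \<open>b\<close>-subsets of an \<open>m\<close>-set through \<open>j\<close> given elements; the case distinction repairs the
  truncated difference \<open>b - j\<close>.\<close>

definition tsets :: "nat \<Rightarrow> nat \<Rightarrow> nat \<Rightarrow> real" where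
  "tsets m b j = (if j \<le> b then real (m - j choose (b - j)) else 0)"

lemma tsets_nonneg: "tsets m b j \<ge> 0"
  by (simp add: tsets_def)

text \<open>The quotient is (b - j) / (m - j), which is largest at j = 1. Comparing only
  \<open>b - 1\<close> with \<open>m - 1\<close> leaves room for deleting a few elements from a
  ground set of size at least 36 k.\<close>

lemma tsets_Suc:
  assumes "36 * (b - 1) \<le> m - 1" "j \<ge> 1" "b \<le> m"
  shows "36 * tsets m b (Suc j) \<le> tsets m b j"
proof (cases "Suc j \<le> b")
  case True
  have "(b - j) * (m - j choose (b - j)) = (m - j) * (m - j - 1 choose (b - j - 1))"
    by (rule times_binomial_minus1_eq) (use True in simp)
  then have "real ((b - j) * (m - j choose (b - j))) = real ((m - j) * (m - Suc j choose (b - Suc j)))"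
    by (simp only: diff_diff_left plus_1_eq_Suc Suc_eq_plus1)
  then have e: "real (m - j) * real (m - Suc j choose (b - Suc j)) = real (b - j) * real (m - j choose (b - j))"
    by (simp only: of_nat_mult)
  have "36 * (b - j) \<le> m - j" using assms True by linarith
  then have le: "36 * real (b - j) \<le> real (m - j)" by linarith
  have pos: "real (b - j) > 0" using True by simp
  have "real (b - j) * (36 * real (m - Suc j choose (b - Suc j))) = (36 * real (b - j)) * real (m - Suc j choose (b - Suc j))" by simp
  also have "\<dots> \<le> real (m - j) * real (m - Suc j choose (b - Suc j))" using le by (rule mult_right_mono) simp
  also have "\<dots> = real (b - j) * real (m - j choose (b - j))" by (rule e)
  finally have "36 * real (m - Suc j choose (b - Suc j)) \<le> real (m - j choose (b - j))" using pos by simp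
  then show ?thesis using True by (simp add: tsets_def)
qed (simp add: tsets_def)

lemma card_many_in_prefix:
  assumes V: "finite V" and B: "\<B> \<subseteq> subsets_of_size V b"
  shows "real (card {B \<in> \<B>. j \<le> card (B \<inter> pre V l)}) \<le> real (l choose j) * tsets (card V) b j"
proof (cases "j \<le> b")
  case True
  let ?J = "{J. J \<subseteq> pre V l \<and> card J = j}"
  have finp: "finite (pre V l)" using V pre_subset finite_subset by blast
  have finJ: "finite ?J" using finp by (auto intro: finite_subset[of _ "Pow (pre V l)"])
  have sub: "{B \<in> \<B>. j \<le> card (B \<inter> pre V l)} \<subseteq> (\<Union>J\<in>?J. {B. B \<subseteq> V \<and> card B = b \<and> J \<subseteq> B})"
  proof
    fix B assume "B \<in> {B \<in> \<B>. j \<le> card (B \<inter> pre V l)}"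
    then have "B \<in> \<B>" "j \<le> card (B \<inter> pre V l)" by auto
    then obtain J where "J \<subseteq> B \<inter> pre V l" "card J = j" by (meson obtain_subset_with_card_n)
    then show "B \<in> (\<Union>J\<in>?J. {B. B \<subseteq> V \<and> card B = b \<and> J \<subseteq> B})"
      using \<open>B \<in> \<B>\<close> B by (intro UN_I[of J]) (auto simp: subsets_of_size_def)
  qed
  have "card {B \<in> \<B>. j \<le> card (B \<inter> pre V l)} \<le> card (\<Union>J\<in>?J. {B. B \<subseteq> V \<and> card B = b \<and> J \<subseteq> B})"
  proof (rule card_mono[OF _ sub])
    show "finite (\<Union>J\<in>?J. {B. B \<subseteq> V \<and> card B = b \<and> J \<subseteq> B})"
      using V by (auto intro: finite_subset[of _ "Pow V"])
  qed
  also have "\<dots> \<le> (\<Sum>J\<in>?J. card {B. B \<subseteq> V \<and> card B = b \<and> J \<subseteq> B})" by (rule card_UN_le[OF finJ])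
  also have "\<dots> = (\<Sum>J\<in>?J. (card V - j choose (b - j)))"
    using True V pre_subset[of V l] by (intro sum.cong refl card_supersets) auto
  also have "\<dots> = (card (pre V l) choose j) * (card V - j choose (b - j))"
    using n_subsets[OF finp] by simp
  also have "\<dots> \<le> (l choose j) * (card V - j choose (b - j))"
    by (intro mult_right_mono binomial_right_mono card_pre_le V) simp
  finally have "real (card {B \<in> \<B>. j \<le> card (B \<inter> pre V l)}) \<le> real ((l choose j) * (card V - j choose (b - j)))"
    by (simp only: of_nat_le_iff)
  then show ?thesis using True by (simp add: tsets_def)
next
  case False
  have "{B \<in> \<B>. j \<le> card (B \<inter> pre V l)} = {}"
  proof -
    have "card (B \<inter> pre V l) \<le> b" if "B \<in> \<B>" for B
      using that B V by (auto simp: subsets_of_size_def intro!: card_mono finite_subset[of B V])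
    then show ?thesis using False by force
  qed
  then have "card {B \<in> \<B>. j \<le> card (B \<inter> pre V l)} = 0" by (simp only: card.empty)
  then show ?thesis using tsets_nonneg[of "card V" b j] by simp
qed

section \<open>Numerical bounds for lattice path sums\<close>

lemma geometric_tail_le:
  fixes s :: "nat \<Rightarrow> real"
  assumes "\<And>j. j \<ge> J \<Longrightarrow> s j \<ge> 0" and "\<And>j. j \<ge> J \<Longrightarrow> 9 * s (Suc j) \<le> s j"
  shows "(\<Sum>j=J..N. s j) \<le> 9 / 8 * s J"
proof (cases "J \<le> N")
  case True
  \<comment> \<open>Subtracting a share of the last term closes the induction. The factor is 1 / (1
    - 1 / 9), and the ratio 9 will arise as 36 / 4.\<close>
  have "(\<Sum>j=J..N. s j) \<le> 9 / 8 * s J - s N / 8" using True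
  proof (induction N rule: dec_induct)
    case (step N)
    then show ?case using assms(2)[of N] by simp
  qed simp
  then show ?thesis using assms(1)[OF True] by simp
next
  case False
  then show ?thesis using assms(1)[of J] by simp
qed

text \<open>Away from the centre, \<open>r\<close> and \<open>n - r\<close> are two different places
  of the row with equal entries.\<close>

lemma binomial_le_half_power:
  assumes "2 * r \<noteq> n"
  shows "2 * (n choose r) \<le> 2 ^ n"
proof (cases "r \<le> n")
  case True
  have "(\<Sum>i\<in>{r, n - r}. n choose i) \<le> (\<Sum>i\<le>n. n choose i)"
    by (rule sum_mono2) (use True in auto)
  moreover have "r \<noteq> n - r" using assms True by auto
  ultimately show ?thesis using True by (simp add: choose_row_sum binomial_symmetric[symmetric])
qed (simp add: binomial_eq_0)

lemma central_binomial_le: "j \<ge> 1 \<Longrightarrow> 2 * real (2 * j choose j) \<le> 4 ^ j"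
proof -
  assume "j \<ge> 1"
  then obtain i where j: "j = Suc i" by (cases j) auto
  \<comment> \<open>Pascal's rule leads to an odd row, which has no central entry.\<close>
  have "(2 * j choose j) = (2 * i + 1 choose i) + (2 * i + 1 choose Suc i)" by (simp add: j)
  moreover have "(2 * i + 1 choose i) = (2 * i + 1 choose Suc i)"
    using binomial_symmetric[of i "2 * i + 1"] by simp
  moreover have "2 * (2 * i + 1 choose i) \<le> 2 ^ (2 * i + 1)" by (rule binomial_le_half_power) presburger
  moreover have "(2::nat) ^ (2 * i + 1) * 2 = 4 ^ j" by (simp add: j power_mult)
  ultimately have "2 * (2 * j choose j) \<le> 4 ^ j" by simp
  then have "real (2 * (2 * j choose j)) \<le> real (4 ^ j)" by (simp only: of_nat_le_iff)
  then show ?thesis by simp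
qed

lemma odd_binomial_le: "real (2 * j + 1 choose r) \<le> 4 ^ j"
proof -
  have "2 * (2 * j + 1 choose r) \<le> 2 ^ (2 * j + 1)" by (rule binomial_le_half_power) presburger
  then have "(2 * j + 1 choose r) \<le> 4 ^ j" by (simp add: power_mult)
  then have "real (2 * j + 1 choose r) \<le> real (4 ^ j)" by (simp only: of_nat_le_iff)
  then show ?thesis by simp
qed

lemma even_binomial_le: "r \<noteq> j \<Longrightarrow> 2 * real (2 * j choose r) \<le> 4 ^ j"
proof -
  assume "r \<noteq> j"
  then have "2 * (2 * j choose r) \<le> 2 ^ (2 * j)" by (intro binomial_le_half_power) simp
  then have "real (2 * (2 * j choose r)) \<le> real (4 ^ j)" by (simp only: of_nat_le_iff power_mult) simp
  then show ?thesis by simp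
qed

lemma sum_split_first: "J \<le> N \<or> s J \<ge> 0 \<Longrightarrow> (\<Sum>j=J..N. s j) \<le> s J + (\<Sum>j=Suc J..N. (s j :: real))"
  by (cases "J \<le> N") (auto simp: sum.atLeast_Suc_atMost)

context
  fixes t :: "nat \<Rightarrow> real"
  assumes t_nonneg: "\<And>j. t j \<ge> 0" and t_Suc: "\<And>j. j \<ge> 1 \<Longrightarrow> 36 * t (Suc j) \<le> t j"
begin

text \<open>Meant for tails only, the first terms being evaluated exactly: used from j = 1 on, it
  would give 2.25 instead of 2.2 in \<open>sum_central_le\<close>.\<close>

lemma tail_le:
  assumes "i + J \<ge> 1" "\<And>j. j \<ge> J \<Longrightarrow> c j \<le> C * 4 ^ j" "C \<ge> 0"
  shows "(\<Sum>j=J..N. c j * t (j + i)) \<le> 9 / 8 * (C * 4 ^ J * t (J + i))"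
proof -
  have "(\<Sum>j=J..N. c j * t (j + i)) \<le> (\<Sum>j=J..N. C * 4 ^ j * t (j + i))"
    by (intro sum_mono mult_right_mono assms t_nonneg) auto
  also have "\<dots> \<le> 9 / 8 * (C * 4 ^ J * t (J + i))"
  proof (rule geometric_tail_le)
    fix j assume "j \<ge> J"
    then have "36 * t (Suc (j + i)) \<le> t (j + i)" using t_Suc[of "j + i"] assms by simp
    from mult_left_mono[OF this, of "C * 4 ^ j"] assms(3)
    show "9 * (C * 4 ^ Suc j * t (Suc j + i)) \<le> C * 4 ^ j * t (j + i)" by (simp add: algebra_simps)
  qed (simp add: assms t_nonneg)
  finally show ?thesis .
qed

lemma sum_central_le: "(\<Sum>j=1..N. real (2 * j choose j) * t j) \<le> 11 / 5 * t 1"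
proof -
  let ?s = "\<lambda>j. real (2 * j choose j) * t j"
  have "(\<Sum>j=1..N. ?s j) \<le> ?s 1 + (?s 2 + (\<Sum>j=3..N. ?s j))"
    using sum_split_first[of 1 N ?s] sum_split_first[of 2 N ?s] t_nonneg
    by (simp add: numeral_2_eq_2 numeral_3_eq_3)
  also have "?s 1 = 2 * t 1" by simp
  also have "?s 2 = 6 * t 2" by (simp add: numeral_eq_Suc)
  also have "(\<Sum>j=3..N. ?s j) \<le> 9 / 8 * (1 / 2 * 4 ^ 3 * t 3)"
  proof -
    have "(\<Sum>j=3..N. real (2 * j choose j) * t (j + 0)) \<le> 9 / 8 * (1 / 2 * 4 ^ 3 * t (3 + 0))"
    proof (rule tail_le)
      fix j :: nat assume "3 \<le> j"
      then show "real (2 * j choose j) \<le> 1 / 2 * 4 ^ j" using central_binomial_le[of j] by simp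
    qed auto
    then show ?thesis by simp
  qed
  \<comment> \<open>2 + 6 / 36 + 36 / 36^2 < 11 / 5.\<close>
  finally show ?thesis using t_Suc[of 1] t_Suc[of 2] t_nonneg[of 1] by (simp add: numeral_2_eq_2 numeral_3_eq_3)
qed

lemma sum_odd_tail_le: "(\<Sum>j=2..N. real (2 * j + 1 choose (j + 2)) * t (j + 2)) \<le> 5 * t 4 + 72 * t 5"
proof -
  let ?s = "\<lambda>j. real (2 * j + 1 choose (j + 2)) * t (j + 2)"
  have "(\<Sum>j=2..N. ?s j) \<le> ?s 2 + (\<Sum>j=3..N. ?s j)"
    using sum_split_first[of 2 N ?s] t_nonneg by (simp add: numeral_3_eq_3)
  also have "?s 2 = 5 * t 4" by (simp add: numeral_eq_Suc)
  also have "(\<Sum>j=3..N. ?s j) \<le> 9 / 8 * (1 * 4 ^ 3 * t (3 + 2))"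
  proof (rule tail_le)
    fix j show "real (2 * j + 1 choose (j + 2)) \<le> 1 * 4 ^ j" unfolding mult_1 by (rule odd_binomial_le)
  qed auto
  finally show ?thesis by simp
qed

lemma sum_odd_le: "(\<Sum>j=1..N. real (2 * j + 1 choose (j + 2)) * t (j + 2)) \<le> 6 / 5 * t 3"
proof -
  let ?s = "\<lambda>j. real (2 * j + 1 choose (j + 2)) * t (j + 2)"
  have "(\<Sum>j=1..N. ?s j) \<le> ?s 1 + (\<Sum>j=2..N. ?s j)"
    using sum_split_first[of 1 N ?s] t_nonneg by (simp add: numeral_2_eq_2)
  also have "?s 1 = t 3" by (simp add: numeral_eq_Suc)
  \<comment> \<open>1 + 5 / 36 + 72 / 36^2 < 6 / 5.\<close>
  finally show ?thesis using sum_odd_tail_le[of N] t_Suc[of 3] t_Suc[of 4] t_nonneg[of 3] by simp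
qed

lemma sum_odd_from_2_le: "t 2 + (\<Sum>j=2..N. real (2 * j + 1 choose (j + 2)) * t (j + 2)) \<le> 51 / 50 * t 2"
  using sum_odd_tail_le[of N] t_Suc[of 2] t_Suc[of 3] t_Suc[of 4] t_nonneg[of 2] by simp

lemma sum_even_from_2_le: "(\<Sum>j=2..N. real (2 * j choose (j + 1)) * t (j + 1)) \<le> 51 / 50 * t 2"
proof -
  let ?s = "\<lambda>j. real (2 * j choose (j + 1)) * t (j + 1)"
  have "(\<Sum>j=2..N. ?s j) \<le> ?s 2 + (\<Sum>j=3..N. ?s j)"
    using sum_split_first[of 2 N ?s] t_nonneg by (simp add: numeral_3_eq_3)
  also have "?s 2 = 4 * t 3" by (simp add: numeral_eq_Suc)
  also have "(\<Sum>j=3..N. ?s j) \<le> 9 / 8 * (1 / 2 * 4 ^ 3 * t (3 + 1))"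
  proof (rule tail_le)
    fix j show "real (2 * j choose (j + 1)) \<le> 1 / 2 * 4 ^ j" using even_binomial_le[of "j + 1" j] by simp
  qed auto
  finally show ?thesis using t_Suc[of 2] t_Suc[of 3] t_nonneg[of 2] by simp
qed

end

section \<open>Sizes of shifted cross-intersecting families\<close>

lemma card_UN_prefix_le:
  assumes V: "finite V" and B: "\<B> \<subseteq> subsets_of_size V b"
    and cov: "\<And>B. B \<in> \<B> \<Longrightarrow> \<exists>j\<ge>J. p j \<le> card (B \<inter> pre V (l j))" and p: "\<And>j. j \<le> p j"
  shows "real (card \<B>) \<le> (\<Sum>j=J..b. real (l j choose p j) * tsets (card V) b (p j))"
proof -
  have fin: "finite \<B>" using B finite_subsets_of_size[OF V] finite_subset by blast
  have "\<B> \<subseteq> (\<Union>j\<in>{J..b}. {B \<in> \<B>. p j \<le> card (B \<inter> pre V (l j))})"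
  proof
    fix B assume BB: "B \<in> \<B>"
    then obtain j where j: "j \<ge> J" "p j \<le> card (B \<inter> pre V (l j))" using cov by blast
    have "card (B \<inter> pre V (l j)) \<le> b"
      using BB B V by (auto simp: subsets_of_size_def intro!: card_mono finite_subset[of B V])
    then have "j \<le> b" using p[of j] j by linarith
    then show "B \<in> (\<Union>j\<in>{J..b}. {B \<in> \<B>. p j \<le> card (B \<inter> pre V (l j))})" using j BB by auto
  qed
  then have "card \<B> \<le> card (\<Union>j\<in>{J..b}. {B \<in> \<B>. p j \<le> card (B \<inter> pre V (l j))})"
    by (rule card_mono[rotated]) (use fin in auto)
  also have "\<dots> \<le> (\<Sum>j=J..b. card {B \<in> \<B>. p j \<le> card (B \<inter> pre V (l j))})" by (rule card_UN_le) simp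
  finally have "real (card \<B>) \<le> real (\<Sum>j=J..b. card {B \<in> \<B>. p j \<le> card (B \<inter> pre V (l j))})"
    by (simp only: of_nat_le_iff)
  also have "\<dots> \<le> (\<Sum>j=J..b. real (l j choose p j) * tsets (card V) b (p j))"
    unfolding of_nat_sum by (intro sum_mono card_many_in_prefix V B)
  finally show ?thesis .
qed

text \<open>If \<open>\<D>\<close> is too large for all its members to cross the path \<open>|B \<inter> pre V (2j)| = j\<close>, then one member staying below
  it forces every member of \<open>\<A>\<close> to have \<open>j + 2\<close> elements among some first \<open>2j + 1\<close>.\<close>

lemma cross_1_shifted_bound:
  assumes V: "finite V" and D: "\<D> \<subseteq> subsets_of_size V b" and A: "\<A> \<subseteq> subsets_of_size V a"
    and sh: "shifted_on V \<D>" and cr: "cross 1 \<A> \<D>"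
    and b: "36 * (b - 1) \<le> card V - 1" "b \<le> card V" and a: "36 * (a - 1) \<le> card V - 1" "a \<le> card V"
  shows "real (card \<D>) \<le> 11 / 5 * tsets (card V) b 1 \<or> real (card \<A>) \<le> 6 / 5 * tsets (card V) a 3"
proof (cases "\<forall>B\<in>\<D>. \<exists>j\<ge>1. j \<le> card (B \<inter> pre V (2 * j))")
  case True
  have "real (card \<D>) \<le> (\<Sum>j=1..b. real (2 * j choose j) * tsets (card V) b j)"
    using card_UN_prefix_le[OF V D, of 1 "\<lambda>j. j" "\<lambda>j. 2 * j"] True by auto
  also have "\<dots> \<le> 11 / 5 * tsets (card V) b 1" by (rule sum_central_le) (use tsets_nonneg tsets_Suc b in auto)
  finally show ?thesis by blast
next
  case False
  then obtain B where B: "B \<in> \<D>" and Bj: "\<And>j. j \<ge> 1 \<Longrightarrow> card (B \<inter> pre V (2 * j)) < j"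
    by (meson not_le)
  have BV: "B \<subseteq> V" using B D by (auto simp: subsets_of_size_def)
  have "\<exists>j\<ge>1. j + 2 \<le> card (F \<inter> pre V (2 * j + 1))" if F: "F \<in> \<A>" for F
  proof -
    have FV: "F \<subseteq> V" using F A by (auto simp: subsets_of_size_def)
    have finp: "finite (pre V l)" for l using V pre_subset finite_subset by blast
    obtain l where l: "l \<ge> 1" "l + 1 \<le> card (F \<inter> pre V l) + card (B \<inter> pre V l)"
      using cross_shifted_prefix[OF V sh _ cr F FV B BV] by auto
    have le: "card (F \<inter> pre V l) \<le> l"
      using card_mono[of "pre V l" "F \<inter> pre V l"] card_pre_le[OF V, of l] finp by simp
    \<comment> \<open>For even \<open>l\<close> the last element of the prefix is dropped, at a cost
      of at most one. Both parities then end at odd prefixes, so a single sum over \<open>j\<close>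
      counts all of \<open>\<A>\<close>.\<close>
    show ?thesis
    proof (cases "even l")
      case True
      then obtain j where j: "l = 2 * j" by blast
      have "j \<ge> 1" using j l by simp
      then have "card (F \<inter> pre V (2 * j)) \<ge> j + 2" using Bj[of j] l(2) unfolding j by linarith
      moreover have "j \<ge> 2" using le calculation j by simp
      moreover have "card (F \<inter> pre V (Suc (2 * (j - 1) + 1))) \<le> card (F \<inter> pre V (2 * (j - 1) + 1)) + 1"
        by (rule card_Int_pre_Suc_le[OF V])
      moreover have "Suc (2 * (j - 1) + 1) = 2 * j" using \<open>j \<ge> 2\<close> by simp
      ultimately show ?thesis by (intro exI[of _ "j - 1"]) auto
    next
      case False
      then obtain j where j: "l = 2 * j + 1" by (metis oddE)
      have "card (B \<inter> pre V l) \<le> card (B \<inter> pre V (2 * (j + 1)))"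
        using finp pre_mono[of l "2 * (j + 1)" V] j by (intro card_mono) auto
      then have "card (F \<inter> pre V l) \<ge> j + 2" using Bj[of "j + 1"] l j by simp
      then show ?thesis using le j by (intro exI[of _ j]) auto
    qed
  qed
  then have "real (card \<A>) \<le> (\<Sum>j=1..a. real (2 * j + 1 choose (j + 2)) * tsets (card V) a (j + 2))"
    by (intro card_UN_prefix_le[OF V A]) auto
  also have "\<dots> \<le> 6 / 5 * tsets (card V) a 3" by (rule sum_odd_le) (use tsets_nonneg tsets_Suc a in auto)
  finally show ?thesis by blast
qed

text \<open>The dividing path is chosen so that the sets through the first two elements form the
  main term for \<open>\<B>\<close>; everything else has a lower order. A \<open>B\<close> below the
  path forces every member of \<open>\<A>\<close> to have \<open>j + 1\<close> of the first
  \<open>2 * j\<close> elements for some j >= 2, which again makes \<open>\<A>\<close>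
  small.\<close>

lemma cross_2_shifted_bound:
  assumes V: "finite V" and B: "\<B> \<subseteq> subsets_of_size V a" and A: "\<A> \<subseteq> subsets_of_size V a"
    and sh: "shifted_on V \<B>" and cr: "cross 2 \<A> \<B>"
    and a: "36 * (a - 1) \<le> card V - 1" "a \<le> card V"
  shows "real (card \<A>) \<le> 51 / 50 * tsets (card V) a 2 \<or> real (card \<B>) \<le> 51 / 50 * tsets (card V) a 2"
proof -
  let ?t = "tsets (card V) a"
  have fB: "finite \<B>" using B finite_subsets_of_size[OF V] finite_subset by blast
  have finp: "finite (pre V l)" for l using V pre_subset finite_subset by blast
  let ?B1 = "{B \<in> \<B>. 2 \<le> card (B \<inter> pre V 2)}"
  show ?thesis
  proof (cases "\<forall>B\<in>\<B> - ?B1. \<exists>j\<ge>2. j + 2 \<le> card (B \<inter> pre V (2 * j + 1))")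
    case True
    have "real (card (\<B> - ?B1)) \<le> (\<Sum>j=2..a. real (2 * j + 1 choose (j + 2)) * ?t (j + 2))"
      using card_UN_prefix_le[OF V, of "\<B> - ?B1" a 2 "\<lambda>j. j + 2" "\<lambda>j. 2 * j + 1"] True B by auto
    moreover have "real (card ?B1) \<le> ?t 2" using card_many_in_prefix[OF V B, of 2 2] by simp
    moreover have "card \<B> = card (\<B> - ?B1) + card ?B1"
      using card_Diff_subset[of ?B1 \<B>] card_mono[of \<B> ?B1] fB by auto
    ultimately have "real (card \<B>) \<le> ?t 2 + (\<Sum>j=2..a. real (2 * j + 1 choose (j + 2)) * ?t (j + 2))" by simp
    also have "\<dots> \<le> 51 / 50 * ?t 2" by (rule sum_odd_from_2_le) (use tsets_nonneg tsets_Suc a in auto)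
    finally show ?thesis by blast
  next
    case False
    then obtain B where "B \<in> \<B> - ?B1" and nj: "\<not> (\<exists>j\<ge>2. j + 2 \<le> card (B \<inter> pre V (2 * j + 1)))"
      by blast
    then have BB: "B \<in> \<B>" and B2: "card (B \<inter> pre V 2) < 2" by auto
    have Bj: "\<And>j. j \<ge> 2 \<Longrightarrow> card (B \<inter> pre V (2 * j + 1)) < j + 2" using nj by (meson not_le)
    have BV: "B \<subseteq> V" using BB B by (auto simp: subsets_of_size_def)
    have "\<exists>j\<ge>2. j + 1 \<le> card (F \<inter> pre V (2 * j))" if F: "F \<in> \<A>" for F
    proof -
      have FV: "F \<subseteq> V" using F A by (auto simp: subsets_of_size_def)
      obtain l where l: "l \<ge> 1" "l + 2 \<le> card (F \<inter> pre V l) + card (B \<inter> pre V l)"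
        using cross_shifted_prefix[OF V sh _ cr F FV BB BV] by auto
      have le: "card (C \<inter> pre V l) \<le> l" for C
        using card_mono[of "pre V l" "C \<inter> pre V l"] card_pre_le[OF V, of l] finp by simp
      \<comment> \<open>The control of \<open>B\<close> by \<open>Bj\<close> starts with the first
        five elements, so short prefixes are separate: l = 1 and l = 2 leave too little room, and
        for l = 3 the set \<open>F\<close> contains the whole prefix.\<close>
      consider "l = 1" | "l = 2" | "l = 3" | j where "l = 2 * j" "j \<ge> 2" | j where "l = 2 * j + 1" "j \<ge> 2"
      proof -
        have "l = 2 * (l div 2) \<or> l = 2 * (l div 2) + 1" by presburger
        moreover have "l div 2 \<ge> 2 \<or> l \<le> 3" by presburger
        ultimately show ?thesis using that l(1) by fastforce
      qed
      then show ?thesis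
      proof cases
        case 1
        then show ?thesis using l le[of F] le[of B] by simp
      next
        case 2
        then show ?thesis using l B2 le[of F] by simp
      next
        case 3
        have "card (B \<inter> pre V 3) \<le> 2" using card_Int_pre_Suc_le[OF V, of B 2] B2 by (simp add: numeral_3_eq_3)
        then have "card (F \<inter> pre V 3) \<ge> 3" using l 3 by simp
        moreover have "card (F \<inter> pre V 3) \<le> card (F \<inter> pre V (2 * 2))"
          using finp pre_mono[of 3 "2 * 2" V] by (intro card_mono) auto
        ultimately show ?thesis by (intro exI[of _ 2]) auto
      next
        case (4 j)
        have "card (B \<inter> pre V l) \<le> card (B \<inter> pre V (2 * j + 1))"
          using finp pre_mono[of l "2 * j + 1" V] 4 by (intro card_mono) auto
        then show ?thesis using Bj[of j] l 4 by (intro exI[of _ j]) auto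
      next
        case (5 j)
        have "card (F \<inter> pre V (Suc (2 * j))) \<le> card (F \<inter> pre V (2 * j)) + 1"
          by (rule card_Int_pre_Suc_le[OF V])
        then show ?thesis using Bj[of j] l 5 by (intro exI[of _ j]) auto
      qed
    qed
    then have "real (card \<A>) \<le> (\<Sum>j=2..a. real (2 * j choose (j + 1)) * ?t (j + 1))"
      by (intro card_UN_prefix_le[OF V A]) auto
    also have "\<dots> \<le> 51 / 50 * ?t 2" by (rule sum_even_from_2_le) (use tsets_nonneg tsets_Suc a in auto)
    finally show ?thesis by blast
  qed
qed

subsection \<open>The first element of a shifted family, and links\<close>

text \<open>Let \<open>l\<close> be maximal with more than half of the first \<open>l\<close> elements in \<open>F\<close>. The members sharing \<open>l\<close> and the part of
  \<open>F\<close> behind these \<open>l\<close> elements form a class that is still shifted on the initial segment, so the first element has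
  there at least the average degree, which exceeds one half.\<close>

lemma shifted_min_majority:
  assumes V: "finite V" and FV: "\<F> \<subseteq> Pow V" and ne: "\<F> \<noteq> {}" and sh: "shifted_on V \<F>"
    and int: "intersecting \<F>" and v1: "v1 \<in> V" "\<And>v. v \<in> V \<Longrightarrow> v1 \<le> v"
  shows "card \<F> < 2 * card {F \<in> \<F>. v1 \<in> F}"
proof -
  have fin: "finite \<F>" using V FV finite_subset by blast
  have finF: "finite F" if "F \<in> \<F>" for F using that FV V finite_subset by blast
  have finp: "finite (pre V l)" for l using V pre_subset finite_subset by blast
  define L where "L F = {l. l < 2 * card (F \<inter> pre V l)}" for F
  define key where "key F = (Max (L F), F - pre V (Max (L F)))" for F
  have finL: "finite (L F)" for F
  proof (rule finite_subset)
    show "L F \<subseteq> {..<2 * card V}"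
    proof
      fix l assume "l \<in> L F"
      moreover have "card (F \<inter> pre V l) \<le> card V" by (rule card_mono[OF V]) (use pre_subset in blast)
      ultimately show "l \<in> {..<2 * card V}" by (simp add: L_def)
    qed
  qed simp
  have neL: "L F \<noteq> {}" if F: "F \<in> \<F>" for F
  proof -
    \<comment> \<open>\<open>F\<close> is compared with itself: the crowded prefix is then one in
      which \<open>F\<close> has the majority.\<close>
    have "cross 1 \<F> \<F>" using int finF
      by (auto simp: cross_def intersecting_def Suc_le_eq card_gt_0_iff)
    from cross_shifted_prefix[OF V sh _ this F _ F] FV F
    obtain l where "l + 1 \<le> card (F \<inter> pre V l) + card (F \<inter> pre V l)" by auto
    then have "l \<in> L F" by (simp add: L_def)
    then show ?thesis by blast
  qed
  have group: "card {F \<in> \<F>. key F = y} < 2 * card {F \<in> \<F>. key F = y \<and> v1 \<in> F}" if y: "y \<in> key ` \<F>" for y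
  proof -
    obtain l R where lR: "y = (l, R)" by (cases y)
    let ?G = "{F \<in> \<F>. key F = y}"
    have finG: "finite ?G" using fin by simp
    have neG: "?G \<noteq> {}" using y by auto
    have lL: "l \<in> L F" and R: "F - pre V l = R" and Lmax: "\<And>l'. l' \<in> L F \<Longrightarrow> l' \<le> l" if "F \<in> ?G" for F
      using that lR Max_in[OF finL neL, of F] Max_ge[OF finL, of _ F] by (auto simp: key_def)
    have l0: "l \<ge> 1"
    proof -
      obtain F where "F \<in> ?G" using neG by blast
      then have "l < 2 * card (F \<inter> pre V l)" using lL by (auto simp: L_def)
      moreover have "card (F \<inter> pre V l) \<le> l"
        using card_mono[of "pre V l" "F \<inter> pre V l"] card_pre_le[OF V, of l] finp by simp
      ultimately show ?thesis by linarith
    qed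
    have v1p: "v1 \<in> pre V l'" if "l' \<ge> l" for l'
    proof -
      have none: "{w \<in> V. w < v1} = {}" using v1 by (auto simp: not_less)
      have "card {w \<in> V. w < v1} < l'" unfolding none using l0 that by simp
      then show ?thesis using v1(1) unfolding pre_def by blast
    qed
    have deg: "card {F \<in> ?G. w \<in> F} \<le> card {F \<in> ?G. v1 \<in> F}" if w: "w \<in> pre V l" for w
    proof (cases "w = v1")
      case False
      have wV: "w \<in> V" using w pre_subset by blast
      have lt: "v1 < w" using False v1(2)[OF wV] by simp
      let ?m = "\<lambda>F. if v1 \<in> F then F else insert v1 (F - {w})"
      have closed: "insert v1 (F - {w}) \<in> ?G" if F: "F \<in> ?G" "w \<in> F" "v1 \<notin> F" for F
      proof -
        let ?F = "insert v1 (F - {w})"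
        have mem: "?F \<in> \<F>" using sh F wV v1 lt unfolding shifted_on_def by blast
        \<comment> \<open>Prefixes from \<open>l\<close> on contain both \<open>v1\<close> and
          \<open>w\<close>. Shorter ones may change, but they do not affect the longest prefix with
          a majority.\<close>
        have same: "card (?F \<inter> pre V l') = card (F \<inter> pre V l')" if "l' \<ge> l" for l'
        proof -
          have w': "w \<in> pre V l'" using w that pre_mono by blast
          have "?F \<inter> pre V l' = insert v1 (F \<inter> pre V l' - {w})" using v1p[OF that] by auto
          moreover have "card (insert v1 (F \<inter> pre V l' - {w})) = Suc (card (F \<inter> pre V l' - {w}))"
            using F finp by (intro card_insert_disjoint) auto
          moreover have "Suc (card (F \<inter> pre V l' - {w})) = card (F \<inter> pre V l')"
            using F w' finp by (intro card_Suc_Diff1) auto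
          ultimately show ?thesis by simp
        qed
        have "Max (L ?F) = l"
        proof (rule Max_eqI[OF finL])
          show "l \<in> L ?F" using lL[OF F(1)] same[of l] by (simp add: L_def)
          fix l' assume l': "l' \<in> L ?F"
          show "l' \<le> l"
          proof (rule ccontr)
            assume "\<not> l' \<le> l"
            then have "l' \<in> L F" using l' same[of l'] by (simp add: L_def)
            then show False using Lmax[OF F(1)] \<open>\<not> l' \<le> l\<close> by blast
          qed
        qed
        moreover have "?F - pre V l = F - pre V l" using v1p[of l] w by auto
        ultimately have "key ?F = y" using R[OF F(1)] lR by (simp add: key_def)
        then show ?thesis using mem by simp
      qed
      show ?thesis
      proof (rule card_inj_on_le)
        show "inj_on ?m {F \<in> ?G. w \<in> F}"
        proof (rule inj_onI)
          fix F H assume FH: "F \<in> {F \<in> ?G. w \<in> F}" "H \<in> {F \<in> ?G. w \<in> F}" and eq: "?m F = ?m H"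
          show "F = H"
          proof (cases "v1 \<in> F \<longleftrightarrow> v1 \<in> H")
            case True
            show ?thesis
            proof (cases "v1 \<in> F")
              case False
              then have nH: "v1 \<notin> H" using True by blast
              have e: "insert v1 (F - {w}) = insert v1 (H - {w})" using eq False nH by simp
              have "F - {w} = insert v1 (F - {w}) - {v1}" using False by auto
              also have "\<dots> = H - {w}" unfolding e using nH by auto
              finally show ?thesis using FH by blast
            qed (use True eq in simp)
          next
            case False
            then show ?thesis using eq FH lt by (auto split: if_splits)
          qed
        qed
        show "?m ` {F \<in> ?G. w \<in> F} \<subseteq> {F \<in> ?G. v1 \<in> F}"
        proof
          fix H assume "H \<in> ?m ` {F \<in> ?G. w \<in> F}"
          then obtain F where F: "F \<in> ?G" "w \<in> F" "H = ?m F" by blast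
          show "H \<in> {F \<in> ?G. v1 \<in> F}"
            using F closed[of F] by (cases "v1 \<in> F") auto
        qed
      qed (use fin in auto)
    qed simp
    \<comment> \<open>Double counting: within the class the average degree over the first
      \<open>l\<close> elements exceeds one half, and none of them has a larger degree than
      \<open>v1\<close>.\<close>
    have "l * card ?G = (\<Sum>F\<in>?G. l)" by simp
    also have "\<dots> < (\<Sum>F\<in>?G. 2 * card (F \<inter> pre V l))"
      by (rule sum_strict_mono[OF finG neG]) (use lL in \<open>auto simp: L_def\<close>)
    also have "\<dots> = 2 * (\<Sum>F\<in>?G. \<Sum>w\<in>pre V l. of_bool (w \<in> F))"
      using finp by (simp add: sum_distrib_left[symmetric] of_bool_def sum.If_cases Int_commute)
    also have "\<dots> = 2 * (\<Sum>w\<in>pre V l. \<Sum>F\<in>?G. of_bool (w \<in> F))" by (subst sum.swap) simp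
    also have "\<dots> = 2 * (\<Sum>w\<in>pre V l. card {F \<in> ?G. w \<in> F})"
      using finG by (simp add: of_bool_def sum.If_cases Int_def)
    also have "\<dots> \<le> 2 * (\<Sum>w\<in>pre V l. card {F \<in> ?G. v1 \<in> F})"
      by (intro mult_left_mono sum_mono deg) auto
    also have "\<dots> \<le> 2 * (l * card {F \<in> ?G. v1 \<in> F})"
      using card_pre_le[OF V, of l] by simp
    finally have "l * card ?G < l * (2 * card {F \<in> ?G. v1 \<in> F})" by simp
    then have "card ?G < 2 * card {F \<in> ?G. v1 \<in> F}" by simp
    moreover have "{F \<in> ?G. v1 \<in> F} = {F \<in> \<F>. key F = y \<and> v1 \<in> F}" by auto
    ultimately show ?thesis by simp
  qed
  have "card \<F> = (\<Sum>y\<in>key ` \<F>. card {F \<in> \<F>. key F = y})"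
    using sum.image_gen[OF fin, of "\<lambda>_. 1::nat" key] by simp
  also have "\<dots> < (\<Sum>y\<in>key ` \<F>. 2 * card {F \<in> \<F>. key F = y \<and> v1 \<in> F})"
    by (rule sum_strict_mono) (use fin ne group in auto)
  also have "\<dots> = 2 * (\<Sum>y\<in>key ` \<F>. \<Sum>F | F \<in> \<F> \<and> key F = y. of_bool (v1 \<in> F))"
  proof -
    have "(\<Sum>F | F \<in> \<F> \<and> key F = y. of_bool (v1 \<in> F)) = card {F \<in> \<F>. key F = y \<and> v1 \<in> F}" for y
      using fin by (simp add: of_bool_def sum.If_cases Int_def conj_assoc)
    then show ?thesis by (simp add: sum_distrib_left)
  qed
  also have "(\<Sum>y\<in>key ` \<F>. \<Sum>F | F \<in> \<F> \<and> key F = y. of_bool (v1 \<in> F)) = (\<Sum>F\<in>\<F>. of_bool (v1 \<in> F))"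
    by (rule sum.image_gen[OF fin, symmetric])
  also have "\<dots> = card {F \<in> \<F>. v1 \<in> F}"
    using fin by (simp add: of_bool_def sum.If_cases Int_def)
  finally show ?thesis .
qed

section \<open>Traces on a small set and the links over them\<close>

definition link :: "nat set \<Rightarrow> nat set \<Rightarrow> nat set set \<Rightarrow> nat set set" where
  "link U S \<F> = (\<lambda>F. F - U) ` {F \<in> \<F>. F \<inter> U = S}"

lemma card_link:
  assumes "finite \<F>"
  shows "real (card (link U S \<F>)) = cnt \<F> (\<lambda>F. F \<inter> U = S)"
proof -
  have "inj_on (\<lambda>F. F - U) {F \<in> \<F>. F \<inter> U = S}" by (rule inj_onI) blast
  then show ?thesis using assms by (simp add: link_def card_image cnt_eq_card)
qed

lemma link_subset:
  assumes "finite X" "\<F> \<subseteq> subsets_of_size X k"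
  shows "link U S \<F> \<subseteq> subsets_of_size (X - U) (k - card S)"
proof
  fix B assume "B \<in> link U S \<F>"
  then obtain F where F: "F \<in> \<F>" "F \<inter> U = S" "B = F - U" by (auto simp: link_def)
  then have FX: "F \<subseteq> X" "card F = k" using assms by (auto simp: subsets_of_size_def)
  then have "finite F" using assms finite_subset by blast
  then have "card F = card S + card B" using card_Int_Diff[of F U] F by simp
  then show "B \<in> subsets_of_size (X - U) (k - card S)" using F FX by (auto simp: subsets_of_size_def)
qed

lemma shifted_on_link:
  assumes "shifted_on W \<F>" "V \<subseteq> W" "V \<inter> U = {}"
  shows "shifted_on V (link U S \<F>)"
  unfolding shifted_on_def
proof (intro ballI impI)
  fix B i j assume B: "B \<in> link U S \<F>" and ij: "i \<in> V" "j \<in> V" and *: "i < j \<and> j \<in> B \<and> i \<notin> B"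
  then obtain F where F: "F \<in> \<F>" "F \<inter> U = S" "B = F - U" by (auto simp: link_def)
  have iU: "i \<notin> U" "j \<notin> U" using ij assms by auto
  have "insert i (F - {j}) \<in> \<F>" using assms F ij * iU unfolding shifted_on_def by blast
  moreover have "insert i (F - {j}) \<inter> U = S" using F iU by auto
  moreover have "insert i (F - {j}) - U = insert i (B - {j})" using F iU by auto
  ultimately show "insert i (B - {j}) \<in> link U S \<F>" unfolding link_def by (metis (mono_tags, lifting) image_eqI mem_Collect_eq)
qed

lemma cross_1_link:
  assumes "intersecting \<F>" "S \<inter> S' = {}" "\<And>F. F \<in> \<F> \<Longrightarrow> finite F"
  shows "cross 1 (link U S \<F>) (link U S' \<F>)"
  unfolding cross_def
proof (intro ballI)
  fix A B assume "A \<in> link U S \<F>" "B \<in> link U S' \<F>"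
  then obtain F G where FG: "F \<in> \<F>" "F \<inter> U = S" "A = F - U" "G \<in> \<F>" "G \<inter> U = S'" "B = G - U" by (auto simp: link_def)
  then have "F \<inter> G \<noteq> {}" using assms by (auto simp: intersecting_def)
  then have "A \<inter> B \<noteq> {}" using FG assms by blast
  moreover have "finite (A \<inter> B)" using FG assms by auto
  ultimately show "1 \<le> card (A \<inter> B)" by (simp add: Suc_le_eq card_gt_0_iff)
qed

text \<open>If two members meet in a single element, moving it to the free element \<open>v\<close> in one of them makes
  them disjoint.\<close>

lemma cross_2_link:
  assumes int: "intersecting \<F>" and dis: "S \<inter> S' = {}" and fin: "\<And>F. F \<in> \<F> \<Longrightarrow> finite F \<and> F \<subseteq> X"
    and sh: "shifted_on W \<F>" and XU: "X - U \<subseteq> W"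
    and v: "v \<in> W" "v \<in> U" "v \<notin> S" "v \<notin> S'" "\<And>w. w \<in> X - U \<Longrightarrow> v < w"
  shows "cross 2 (link U S \<F>) (link U S' \<F>)"
  unfolding cross_def
proof (intro ballI)
  fix A B assume AB: "A \<in> link U S \<F>" "B \<in> link U S' \<F>"
  then obtain F G where FG: "F \<in> \<F>" "F \<inter> U = S" "A = F - U" "G \<in> \<F>" "G \<inter> U = S'" "B = G - U" by (auto simp: link_def)
  have eq: "F \<inter> G = A \<inter> B" using FG dis by blast
  have "1 \<le> card (A \<inter> B)" using cross_1_link[OF int dis, of U] AB fin by (auto simp: cross_def)
  moreover have "card (A \<inter> B) \<noteq> 1"
  proof
    assume "card (A \<inter> B) = 1"
    then obtain w where w: "A \<inter> B = {w}" by (metis card_1_singletonE)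
    then have wF: "w \<in> F" "w \<in> X - U" using FG fin by auto
    have "v \<notin> F" "v \<notin> G" using v FG by auto
    then have "insert v (F - {w}) \<in> \<F>" using sh FG wF v XU unfolding shifted_on_def by blast
    then have "insert v (F - {w}) \<inter> G \<noteq> {}" using int FG(4) unfolding intersecting_def by blast
    then show False using \<open>v \<notin> G\<close> eq w by auto
  qed
  ultimately show "2 \<le> card (A \<inter> B)" by linarith
qed

text \<open>Shifts inside \<open>X - U\<close> do not touch traces on \<open>U\<close>, so nothing
  stops them: a bound on trace counts may be proved for a shifted family.\<close>

lemma shift_outside:
  assumes X: "finite X" and F: "\<F> \<subseteq> subsets_of_size X k" and int: "intersecting \<F>"
  obtains \<G> where "\<G> \<subseteq> subsets_of_size X k" "intersecting \<G>" "shifted_on (X - U) \<G>"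
    "\<And>P. cnt \<G> (\<lambda>F. P (F \<inter> U)) = cnt \<F> (\<lambda>F. P (F \<inter> U))"
proof -
  let ?Q = "\<lambda>\<G>. \<G> \<subseteq> subsets_of_size X k \<and> intersecting \<G> \<and> (\<forall>P. cnt \<G> (\<lambda>F. P (F \<inter> U)) = cnt \<F> (\<lambda>F. P (F \<inter> U)))"
  have Q0: "?Q \<F>" using assms by simp
  have fin: "finite \<G> \<and> (\<forall>F\<in>\<G>. finite F)" if "?Q \<G>" for \<G>
    using that finite_subsets_of_size[OF X] finite_subset[OF _ X]
    by (auto simp: subsets_of_size_def dest: finite_subset)
  show ?thesis
  proof (rule shift_ad_extremis[of ?Q \<F> "X - U"])
    fix \<G> i j assume Q: "?Q \<G>" and ij: "i \<in> X - U" "j \<in> X - U" "i < j" and "\<not> ?Q (shift i j \<G>)"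
    moreover have "?Q (shift i j \<G>)"
    proof (intro conjI allI)
      show "shift i j \<G> \<subseteq> subsets_of_size X k" using Q ij X by (intro shift_subset) auto
      show "intersecting (shift i j \<G>)" using Q ij by (intro intersecting_shift) auto
      fix P
      have "cnt (shift i j \<G>) (\<lambda>F. P (F \<inter> U)) = cnt \<G> (\<lambda>F. P (F \<inter> U))"
        by (rule cnt_shift) (use ij in \<open>auto intro!: arg_cong[of _ _ P]\<close>)
      then show "cnt (shift i j \<G>) (\<lambda>F. P (F \<inter> U)) = cnt \<F> (\<lambda>F. P (F \<inter> U))" using Q by simp
    qed
    ultimately show thesis by blast
  qed (use Q0 fin that in auto)
qed

lemma tsets_three_le:
  assumes "k \<ge> 3" "c \<le> 1" "m + 2 \<le> n" "m \<ge> 3"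
  shows "tsets m (k - c) 3 \<le> real (n - 3 choose (k - 3))"
proof (cases "c = 0 \<or> k = 3")
  case True
  then show ?thesis using assms by (auto simp: tsets_def intro!: binomial_right_mono)
next
  case False
  define q where "q = k - 4"
  have k: "k = q + 4" and c: "c = 1" using False assms by (auto simp: q_def)
  define r where "r = n - 4"
  have r: "n - 3 = Suc r" "m - 3 \<le> r" using assms by (auto simp: r_def)
  have "(m - 3 choose q) \<le> (r choose q)" using r by (intro binomial_right_mono)
  also have "\<dots> \<le> (n - 3 choose (q + 1))" using r by simp
  finally show ?thesis using k c by (simp add: tsets_def)
qed

text \<open>The main terms are the sets through one point in the link over \<open>S\<close> and
  through three points in the link over \<open>S'\<close>. As \<open>U\<close> has at least two
  elements, both binomials are at most \<open>M\<close>.\<close>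

lemma link_2_bound:
  assumes X: "finite X" "36 * k \<le> card X" and k: "k \<ge> 3" and F: "\<F> \<subseteq> subsets_of_size X k" and int: "intersecting \<F>"
    and U: "U \<subseteq> X" "2 \<le> card U" "card U \<le> 4"
    and S: "S \<inter> S' = {}" "card S = 2" "card S' \<le> 1"
  shows "cnt \<F> (\<lambda>F. F \<inter> U = S) \<le> 11 / 5 * real (card X - 3 choose (k - 3)) \<or>
         cnt \<F> (\<lambda>F. F \<inter> U = S') \<le> 6 / 5 * real (card X - 3 choose (k - 3))"
proof -
  obtain \<G> where G: "\<G> \<subseteq> subsets_of_size X k" "intersecting \<G>" "shifted_on (X - U) \<G>"
    "\<And>P. cnt \<G> (\<lambda>F. P (F \<inter> U)) = cnt \<F> (\<lambda>F. P (F \<inter> U))"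
    using shift_outside[OF X(1) F int, of U] by blast
  have finG: "finite \<G>" using G(1) finite_subsets_of_size[OF X(1)] finite_subset by blast
  have finm: "finite F" if "F \<in> \<G>" for F using that G(1) X(1) by (auto simp: subsets_of_size_def intro: finite_subset)
  let ?V = "X - U"
  have V: "finite ?V" using X by simp
  have m: "card ?V = card X - card U" using U(1) X(1) by (simp add: card_Diff_subset finite_subset)
  have "real (card (link U S \<G>)) \<le> 11 / 5 * tsets (card ?V) (k - 2) 1 \<or>
        real (card (link U S' \<G>)) \<le> 6 / 5 * tsets (card ?V) (k - card S') 3"
  proof (rule cross_1_shifted_bound[OF V])
    show "link U S \<G> \<subseteq> subsets_of_size ?V (k - 2)" using link_subset[OF X(1) G(1), of U S] S by simp
    show "link U S' \<G> \<subseteq> subsets_of_size ?V (k - card S')" using link_subset[OF X(1) G(1)] .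
    show "shifted_on ?V (link U S \<G>)" using G(3) by (rule shifted_on_link) auto
    show "cross 1 (link U S' \<G>) (link U S \<G>)" using S finm G by (intro cross_1_link) auto
  qed (use m U X(2) k in linarith)+
  moreover have "tsets (card ?V) (k - 2) 1 \<le> real (card X - 3 choose (k - 3))"
    using k m U by (auto simp: tsets_def diff_diff_left intro!: binomial_right_mono)
  moreover have "tsets (card ?V) (k - card S') 3 \<le> real (card X - 3 choose (k - 3))"
    by (rule tsets_three_le) (use k m U X(2) S in linarith)+
  moreover have "cnt \<F> (\<lambda>F. F \<inter> U = T) = real (card (link U T \<G>))" for T
    using card_link[OF finG, of U T] G(4)[of "\<lambda>A. A = T"] by simp
  ultimately show ?thesis by fastforce
qed

text \<open>The element \<open>v\<close>, missed by both traces and smaller than everything outside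
  \<open>U\<close>, makes the links cross-intersecting in two elements. The main term then fixes two
  points of the link besides \<open>s\<close>, again three in all.\<close>

lemma link_1_shifted_bound:
  assumes X: "finite X" "36 * k \<le> card X" and k: "k \<ge> 3" and F: "\<F> \<subseteq> subsets_of_size X k" and int: "intersecting \<F>"
    and sh: "shifted_on W \<F>" and XU: "X - U \<subseteq> W" and U: "U \<subseteq> X" "1 \<le> card U" "card U \<le> 5"
    and v: "v \<in> W" "v \<in> U" "v \<noteq> s" "v \<noteq> s'" "\<And>w. w \<in> X - U \<Longrightarrow> v < w" and s: "s \<noteq> s'"
  shows "cnt \<F> (\<lambda>F. F \<inter> U = {s}) \<le> 51 / 50 * real (card X - 3 choose (k - 3)) \<or>
         cnt \<F> (\<lambda>F. F \<inter> U = {s'}) \<le> 51 / 50 * real (card X - 3 choose (k - 3))"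
proof -
  have finF: "finite \<F>" using F finite_subsets_of_size[OF X(1)] finite_subset by blast
  let ?V = "X - U"
  have V: "finite ?V" using X by simp
  have m: "card ?V = card X - card U" using U(1) X(1) by (simp add: card_Diff_subset finite_subset)
  have "real (card (link U {s} \<F>)) \<le> 51 / 50 * tsets (card ?V) (k - 1) 2 \<or>
        real (card (link U {s'} \<F>)) \<le> 51 / 50 * tsets (card ?V) (k - 1) 2"
  proof (rule cross_2_shifted_bound[OF V])
    show "link U {s} \<F> \<subseteq> subsets_of_size ?V (k - 1)" using link_subset[OF X(1) F, of U "{s}"] by simp
    show "link U {s'} \<F> \<subseteq> subsets_of_size ?V (k - 1)" using link_subset[OF X(1) F, of U "{s'}"] by simp
    show "shifted_on ?V (link U {s'} \<F>)" using sh XU by (rule shifted_on_link) auto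
    show "cross 2 (link U {s} \<F>) (link U {s'} \<F>)"
    proof (rule cross_2_link[OF int _ _ sh XU v(1,2)])
      fix F assume "F \<in> \<F>"
      then show "finite F \<and> F \<subseteq> X" using F X(1) by (auto simp: subsets_of_size_def intro: finite_subset)
    qed (use v s in auto)
  qed (use m U X(2) k in linarith)+
  moreover have "tsets (card ?V) (k - 1) 2 \<le> real (card X - 3 choose (k - 3))"
    using k m U by (auto simp: tsets_def diff_diff_left numeral_3_eq_3 intro!: binomial_right_mono)
  ultimately show ?thesis by (fastforce simp: card_link[OF finF])
qed

subsection \<open>Elements of large degree\<close>

text \<open>The union bound. With a list of events the right-hand side unfolds to an explicit sum,
  nested to the right, as it appears in the estimates below.\<close>

lemma cnt_le_sum_list:
  assumes "\<And>F. F \<in> \<F> \<Longrightarrow> P F \<Longrightarrow> \<exists>Q\<in>set Qs. Q F"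
  shows "cnt \<F> P \<le> (\<Sum>Q\<leftarrow>Qs. cnt \<F> Q)"
proof -
  have "cnt \<F> P \<le> (\<Sum>F\<in>\<F>. \<Sum>Q\<leftarrow>Qs. of_bool (Q F))"
    unfolding cnt_def
  proof (rule sum_mono)
    fix F assume F: "F \<in> \<F>"
    have nn: "(\<Sum>Q\<leftarrow>Qs'. of_bool (Q F)) \<ge> (0::real)" for Qs' by (induction Qs') auto
    have "(1::real) \<le> (\<Sum>Q\<leftarrow>Qs'. of_bool (Q F))" if "Q \<in> set Qs'" "Q F" for Q Qs'
      using that nn by (induction Qs') (auto intro: add_increasing add_increasing2)
    then show "of_bool (P F) \<le> (\<Sum>Q\<leftarrow>Qs. of_bool (Q F) :: real)"
      using assms[OF F] nn[of Qs] by (cases "P F") auto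
  qed
  also have "\<dots> = (\<Sum>Q\<leftarrow>Qs. cnt \<F> Q)"
    unfolding cnt_def by (induction Qs) (auto simp: sum.distrib)
  finally show ?thesis .
qed

lemma cnt_mono: "(\<And>F. F \<in> \<F> \<Longrightarrow> P F \<Longrightarrow> Q F) \<Longrightarrow> cnt \<F> P \<le> cnt \<F> Q"
  using cnt_le_sum_list[of \<F> P "[Q]"] by auto

lemma cnt_inclusion_exclusion:
  "cnt \<F> (\<lambda>F. x \<in> F) + cnt \<F> (\<lambda>F. y \<in> F) + cnt \<F> (\<lambda>F. x \<notin> F \<and> y \<notin> F)
    = real (card \<F>) + cnt \<F> (\<lambda>F. x \<in> F \<and> y \<in> F)"
proof -
  have "real (card \<F>) = (\<Sum>F\<in>\<F>. 1)" by simp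
  then show ?thesis
    unfolding cnt_def by (simp only: sum.distrib[symmetric]) (auto intro!: sum.cong)
qed

lemma cnt_True: "cnt \<F> (\<lambda>_. True) = real (card \<F>)"
  by (simp add: cnt_def)

text \<open>The ground set is arbitrary because the degree bound is also applied after deleting an
  element; the weak inequality \<open>cardX\<close> is what survives of 36 k < n then.\<close>

locale ground =
  fixes X :: "nat set" and k :: nat
  assumes finX: "finite X" and cardX: "36 * k \<le> card X" and k3: "k \<ge> 3"
begin

definition M :: real where "M = real (card X - 3 choose (k - 3))"

lemma M_pos: "M > 0"
  using cardX k3 by (simp add: M_def zero_less_binomial)

abbreviation "fam \<F> \<equiv> \<F> \<subseteq> subsets_of_size X k \<and> intersecting \<F>"

lemma fam_finite: "fam \<F> \<Longrightarrow> finite \<F>"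
  using finite_subsets_of_size[OF finX] finite_subset by blast

lemma fam_mem: "fam \<F> \<Longrightarrow> F \<in> \<F> \<Longrightarrow> finite F \<and> F \<subseteq> X"
  using finX by (auto simp: subsets_of_size_def intro: finite_subset)

lemma fam_shift: "fam \<F> \<Longrightarrow> i \<in> X \<Longrightarrow> i \<noteq> j \<Longrightarrow> fam (shift i j \<F>)"
  using shift_subset[OF _ _ finX] intersecting_shift by blast

lemma pair_dichotomy:
  assumes "fam \<F>" "x \<in> X" "y \<in> X" "x \<noteq> y"
  shows "cnt \<F> (\<lambda>F. x \<in> F \<and> y \<in> F) \<le> 11 / 5 * M \<or> cnt \<F> (\<lambda>F. x \<notin> F \<and> y \<notin> F) \<le> 6 / 5 * M"
proof -
  have "cnt \<F> (\<lambda>F. F \<inter> {x, y} = {x, y}) \<le> 11 / 5 * M \<or> cnt \<F> (\<lambda>F. F \<inter> {x, y} = {}) \<le> 6 / 5 * M"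
    unfolding M_def by (rule link_2_bound[OF finX cardX k3]) (use assms in auto)
  moreover have "(F \<inter> {x, y} = {x, y}) = (x \<in> F \<and> y \<in> F)" "(F \<inter> {x, y} = {}) = (x \<notin> F \<and> y \<notin> F)" for F
    by auto
  ultimately show ?thesis by simp
qed

definition balanced :: "nat set set \<Rightarrow> bool" where
  "balanced \<F> \<longleftrightarrow> fam \<F> \<and> (\<forall>x\<in>X. 2 * cnt \<F> (\<lambda>F. x \<in> F) \<le> real (card \<F>))"

text \<open>Two degrees of at most one half imply that no more members contain both elements than
  avoid both, which rules out the second alternative of \<open>pair_dichotomy\<close> for a frequent
  pair.\<close>

lemma balanced_pair:
  assumes "balanced \<F>" "x \<in> X" "y \<in> X" "x \<noteq> y"
  shows "cnt \<F> (\<lambda>F. x \<in> F \<and> y \<in> F) \<le> 11 / 5 * M"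
proof -
  have "2 * cnt \<F> (\<lambda>F. x \<in> F) \<le> real (card \<F>)" "2 * cnt \<F> (\<lambda>F. y \<in> F) \<le> real (card \<F>)"
    using assms by (auto simp: balanced_def)
  then have "cnt \<F> (\<lambda>F. x \<in> F \<and> y \<in> F) \<le> cnt \<F> (\<lambda>F. x \<notin> F \<and> y \<notin> F)"
    using cnt_inclusion_exclusion[of \<F> x y] by linarith
  moreover have "fam \<F>" using assms by (simp add: balanced_def)
  ultimately show ?thesis using pair_dichotomy[of \<F> x y] assms M_pos by linarith
qed

text \<open>Only the degrees of \<open>i\<close> and \<open>j\<close> can change, and both are
  bounded by the number of members hitting \<open>{i, j}\<close>, which the shift preserves.\<close>

lemma shift_unbalances:
  assumes b: "balanced \<F>" and nb: "\<not> balanced (shift i j \<F>)" and ij: "i \<in> X" "j \<in> X" "i \<noteq> j"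
  shows "real (card \<F>) < 2 * cnt \<F> (\<lambda>F. i \<in> F \<or> j \<in> F)"
proof -
  have "fam (shift i j \<F>)" using b ij fam_shift by (auto simp: balanced_def)
  then obtain v where v: "v \<in> X" "real (card \<F>) < 2 * cnt (shift i j \<F>) (\<lambda>F. v \<in> F)"
    using nb by (auto simp: balanced_def card_shift not_le)
  show ?thesis
  proof (cases "v \<in> {i, j}")
    case True
    then have "cnt (shift i j \<F>) (\<lambda>F. v \<in> F) \<le> cnt (shift i j \<F>) (\<lambda>F. i \<in> F \<or> j \<in> F)" by (intro cnt_mono) auto
    also have "\<dots> = cnt \<F> (\<lambda>F. i \<in> F \<or> j \<in> F)" by (rule cnt_shift) auto
    finally show ?thesis using v by simp
  next
    case False
    then have "cnt (shift i j \<F>) (\<lambda>F. v \<in> F) = cnt \<F> (\<lambda>F. v \<in> F)" by (intro cnt_shift) auto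
    then show ?thesis using b v by (auto simp: balanced_def)
  qed
qed

lemma hitting_pair_exists:
  assumes b: "balanced \<F>" and ne: "\<F> \<noteq> {}"
  obtains \<G> x y where "balanced \<G>" "card \<G> = card \<F>" "x \<in> X" "y \<in> X" "x \<noteq> y"
    "real (card \<F>) < 2 * cnt \<G> (\<lambda>F. x \<in> F \<or> y \<in> F)"
proof (rule shift_ad_extremis[of "\<lambda>\<G>. balanced \<G> \<and> card \<G> = card \<F>" \<F> X])
  fix \<G> assume G: "balanced \<G> \<and> card \<G> = card \<F>" and sh: "shifted_on X \<G>"
  have fG: "fam \<G>" using G by (simp add: balanced_def)
  have "card \<F> > 0" using ne b fam_finite by (auto simp: balanced_def card_gt_0_iff)
  then have neG: "\<G> \<noteq> {}" using G by auto
  have Xne: "X \<noteq> {}" using cardX k3 by auto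
  have "card \<G> < 2 * card {F \<in> \<G>. Min X \<in> F}"
    by (rule shifted_min_majority[OF finX _ neG sh]) (use fG fam_mem finX Xne in auto)
  then have "real (card \<G>) < 2 * cnt \<G> (\<lambda>F. Min X \<in> F)"
    unfolding cnt_eq_card[OF fam_finite[OF fG]] by linarith
  moreover have "Min X \<in> X" using finX Xne by simp
  ultimately show thesis using G by (auto simp: balanced_def)
next
  fix \<G> i j
  assume "balanced \<G> \<and> card \<G> = card \<F>" "i \<in> X" "j \<in> X" "i < j"
    "\<not> (balanced (shift i j \<G>) \<and> card (shift i j \<G>) = card \<F>)"
  then show thesis using that shift_unbalances[of \<G> i j] by (auto simp: card_shift)
qed (use b fam_finite fam_mem in \<open>auto simp: balanced_def\<close>)

lemma second_hitting_pair:
  assumes b: "balanced \<F>" and xy: "real (card \<F>) < 2 * cnt \<F> (\<lambda>F. x \<in> F \<or> y \<in> F)"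
  obtains (shifted) \<G> where "balanced \<G>" "card \<G> = card \<F>"
      "real (card \<F>) < 2 * cnt \<G> (\<lambda>F. x \<in> F \<or> y \<in> F)" "shifted_on (X - {x, y}) \<G>"
  | (pair) \<G> u v where "balanced \<G>" "card \<G> = card \<F>"
      "real (card \<F>) < 2 * cnt \<G> (\<lambda>F. x \<in> F \<or> y \<in> F)" "u \<in> X - {x, y}" "v \<in> X - {x, y}" "u \<noteq> v"
      "real (card \<F>) < 2 * cnt \<G> (\<lambda>F. u \<in> F \<or> v \<in> F)"
proof (rule shift_ad_extremis[of "\<lambda>\<G>. balanced \<G> \<and> card \<G> = card \<F> \<and>
     real (card \<F>) < 2 * cnt \<G> (\<lambda>F. x \<in> F \<or> y \<in> F)" \<F> "X - {x, y}"])
  fix \<G> i j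
  assume Q: "balanced \<G> \<and> card \<G> = card \<F> \<and> real (card \<F>) < 2 * cnt \<G> (\<lambda>F. x \<in> F \<or> y \<in> F)"
    and ij: "i \<in> X - {x, y}" "j \<in> X - {x, y}" "i < j"
    and nQ: "\<not> (balanced (shift i j \<G>) \<and> card (shift i j \<G>) = card \<F> \<and>
       real (card \<F>) < 2 * cnt (shift i j \<G>) (\<lambda>F. x \<in> F \<or> y \<in> F))"
  have "cnt (shift i j \<G>) (\<lambda>F. x \<in> F \<or> y \<in> F) = cnt \<G> (\<lambda>F. x \<in> F \<or> y \<in> F)"
    by (rule cnt_shift) (use ij in auto)
  then have "\<not> balanced (shift i j \<G>)" using Q nQ by (simp add: card_shift)
  then show thesis using pair[of \<G> i j] Q ij shift_unbalances[of \<G> i j] by auto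
qed (use b xy fam_finite fam_mem shifted in \<open>auto simp: balanced_def\<close>)

text \<open>If \<open>y\<close> is rarely alone on the four elements, then \<open>x\<close> is
  often: 17.5 - 5 * 2.2 - 1.02 > 5.4. This makes the traces \<open>{v1}\<close> and
  \<open>{v1, v2}\<close> rare. As \<open>v1\<close> lies in more than half of the members avoiding
  \<open>x\<close> and \<open>y\<close> (if there are any), these number at most 2 * (1.02 + 2.2)
  \<open>M\<close>, and \<open>x\<close> gets too large a degree.\<close>

lemma one_pair_contradiction_asym:
  assumes b: "balanced \<F>" and f: "35 * M \<le> real (card \<F>)"
    and xy: "real (card \<F>) < 2 * cnt \<F> (\<lambda>F. x \<in> F \<or> y \<in> F)"
    and sh: "shifted_on (X - {x, y}) \<F>"
    and x: "x \<in> X" "y \<in> X" "x \<noteq> y" and v: "v1 \<in> X - {x, y}" "v2 \<in> X - {x, y}" "v1 < v2"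
      "\<And>w. w \<in> X - {x, y, v1, v2} \<Longrightarrow> v2 < w"
    and y: "cnt \<F> (\<lambda>F. F \<inter> {x, y, v1, v2} = {y}) \<le> 51 / 50 * M"
  shows False
proof -
  let ?U = "{x, y, v1, v2}"
  let ?n = "\<lambda>S. cnt \<F> (\<lambda>F. F \<inter> ?U = S)"
  let ?p = "\<lambda>a b. cnt \<F> (\<lambda>F. a \<in> F \<and> b \<in> F)"
  have fam: "fam \<F>" using b by (simp add: balanced_def)
  have U: "?U \<subseteq> X" "card ?U = 4" using x v by auto
  have p: "?p x y \<le> 11 / 5 * M" "?p x v1 \<le> 11 / 5 * M" "?p x v2 \<le> 11 / 5 * M" "?p y v1 \<le> 11 / 5 * M" "?p y v2 \<le> 11 / 5 * M"
    using balanced_pair[OF b] x v by auto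
  have "cnt \<F> (\<lambda>F. x \<in> F \<or> y \<in> F) \<le> ?p x y + (?p x v1 + (?p x v2 + (?p y v1 + (?p y v2 + (?n {x} + ?n {y})))))"
    using cnt_le_sum_list[of \<F> "\<lambda>F. x \<in> F \<or> y \<in> F" "[\<lambda>F. x \<in> F \<and> y \<in> F, \<lambda>F. x \<in> F \<and> v1 \<in> F, \<lambda>F. x \<in> F \<and> v2 \<in> F,
       \<lambda>F. y \<in> F \<and> v1 \<in> F, \<lambda>F. y \<in> F \<and> v2 \<in> F, \<lambda>F. F \<inter> ?U = {x}, \<lambda>F. F \<inter> ?U = {y}]"] by force
  then have nx: "?n {x} > 27 / 5 * M" using p y f xy M_pos by linarith
  have XU: "X - ?U \<subseteq> X - {x, y}" by auto
  have "?n {x} \<le> 51 / 50 * M \<or> ?n {v1} \<le> 51 / 50 * M"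
    unfolding M_def
    by (rule link_1_shifted_bound[OF finX cardX k3 _ _ sh XU U(1), of v2]) (use fam U x v in auto)
  then have n1: "?n {v1} \<le> 51 / 50 * M" using nx M_pos by linarith
  have "?n {v1, v2} \<le> 11 / 5 * M \<or> ?n {x} \<le> 6 / 5 * M"
    unfolding M_def
    by (rule link_2_bound[OF finX cardX k3 _ _ U(1)]) (use fam U x v in auto)
  then have n12: "?n {v1, v2} \<le> 11 / 5 * M" using nx M_pos by linarith
  let ?C = "{F \<in> \<F>. x \<notin> F \<and> y \<notin> F}"
  have finF: "finite \<F>" using fam fam_finite by blast
  have C: "real (card ?C) \<le> 2 * cnt \<F> (\<lambda>F. x \<notin> F \<and> y \<notin> F \<and> v1 \<in> F)"
  proof (cases "?C = {}")
    case True
    then show ?thesis using cnt_nonneg by (simp only: card.empty) simp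
  next
    case False
    have "card ?C < 2 * card {F \<in> ?C. v1 \<in> F}"
    proof (rule shifted_min_majority[of "X - {x, y}"])
      show "shifted_on (X - {x, y}) ?C" using sh by (auto simp: shifted_on_def)
      show "intersecting ?C" using fam by (auto simp: intersecting_def)
      show "v1 \<le> w" if "w \<in> X - {x, y}" for w using that v(3) v(4)[of w] by (cases "w \<in> {v1, v2}") auto
    qed (use finX False v fam fam_mem in auto)
    moreover have "{F \<in> ?C. v1 \<in> F} = {F \<in> \<F>. x \<notin> F \<and> y \<notin> F \<and> v1 \<in> F}" by auto
    ultimately show ?thesis by (simp add: cnt_eq_card[OF finF])
  qed
  have "cnt \<F> (\<lambda>F. x \<notin> F \<and> y \<notin> F \<and> v1 \<in> F) \<le> ?n {v1} + ?n {v1, v2}"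
    using cnt_le_sum_list[of \<F> "\<lambda>F. x \<notin> F \<and> y \<notin> F \<and> v1 \<in> F" "[\<lambda>F. F \<inter> ?U = {v1}, \<lambda>F. F \<inter> ?U = {v1, v2}]"] by force
  moreover have "real (card \<F>) \<le> cnt \<F> (\<lambda>F. x \<in> F) + (?p y v1 + (?p y v2 + (?n {y} + cnt \<F> (\<lambda>F. x \<notin> F \<and> y \<notin> F))))"
    using cnt_le_sum_list[of \<F> "\<lambda>F. True" "[\<lambda>F. x \<in> F, \<lambda>F. y \<in> F \<and> v1 \<in> F, \<lambda>F. y \<in> F \<and> v2 \<in> F, \<lambda>F. F \<inter> ?U = {y}, \<lambda>F. x \<notin> F \<and> y \<notin> F]"]
    by (force simp: cnt_True)
  moreover have "2 * cnt \<F> (\<lambda>F. x \<in> F) \<le> real (card \<F>)" using b x by (simp add: balanced_def)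
  moreover have "real (card ?C) = cnt \<F> (\<lambda>F. x \<notin> F \<and> y \<notin> F)" by (simp add: cnt_eq_card[OF finF])
  \<comment> \<open>At most (2.2 + 2.2 + 1.02 + 6.44) \<open>M\<close> members avoid
    \<open>x\<close>, fewer than the half that balance requires.\<close>
  ultimately show False using C n1 n12 y p f M_pos by linarith
qed

text \<open>The smallest remaining element \<open>v1\<close> is free for both traces
  \<open>{x}\<close> and \<open>{y}\<close>, so one of them is rare; the two cases differ by
  exchanging \<open>x\<close> and \<open>y\<close>.\<close>

lemma one_pair_contradiction:
  assumes b: "balanced \<F>" and f: "35 * M \<le> real (card \<F>)"
    and xy: "real (card \<F>) < 2 * cnt \<F> (\<lambda>F. x \<in> F \<or> y \<in> F)"
    and sh: "shifted_on (X - {x, y}) \<F>"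
    and x: "x \<in> X" "y \<in> X" "x \<noteq> y"
  shows False
proof -
  let ?V = "X - {x, y}"
  have V: "finite ?V" using finX by simp
  have cV: "card ?V \<ge> 2" using x finX cardX k3 by simp
  define v1 where "v1 = Min ?V"
  have "?V \<noteq> {}" using cV by (metis card.empty not_numeral_le_zero)
  then have v1: "v1 \<in> ?V" "\<And>w. w \<in> ?V \<Longrightarrow> v1 \<le> w" using V by (auto simp: v1_def simp del: Diff_insert Diff_iff)
  define v2 where "v2 = Min (?V - {v1})"
  have "card (?V - {v1}) \<ge> 1" using cV v1 V by (subst card_Diff_singleton) auto
  then have "?V - {v1} \<noteq> {}" by (metis card.empty not_one_le_zero)
  then have v2: "v2 \<in> ?V - {v1}" "\<And>w. w \<in> ?V - {v1} \<Longrightarrow> v2 \<le> w"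
    using V unfolding v2_def by (meson Min_in finite_Diff, meson Min_le finite_Diff)
  have lt: "v1 < v2" using v1(2)[of v2] v2(1) by auto
  have rest: "v2 < w" if "w \<in> X - {x, y, v1, v2}" for w using v2(2)[of w] that by auto
  let ?U = "{x, y, v1, v2}"
  have XU: "X - ?U \<subseteq> ?V" by auto
  have fam: "fam \<F>" using b by (simp add: balanced_def)
  have "cnt \<F> (\<lambda>F. F \<inter> ?U = {x}) \<le> 51 / 50 * M \<or> cnt \<F> (\<lambda>F. F \<inter> ?U = {y}) \<le> 51 / 50 * M"
    unfolding M_def
    by (rule link_1_shifted_bound[OF finX cardX k3 _ _ sh XU, of v1]) (use fam x v1 v2 lt rest in force)+
  then show False
  proof
    assume "cnt \<F> (\<lambda>F. F \<inter> ?U = {y}) \<le> 51 / 50 * M"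
    then show False
      using one_pair_contradiction_asym[OF b f xy sh x, of v1 v2] v1 v2 lt rest by blast
  next
    assume "cnt \<F> (\<lambda>F. F \<inter> ?U = {x}) \<le> 51 / 50 * M"
    moreover have eq: "{y, x, v1, v2} = ?U" "{y, x} = {x, y}" by auto
    moreover have "(\<lambda>F. y \<in> F \<or> x \<in> F) = (\<lambda>F. x \<in> F \<or> y \<in> F)" by auto
    ultimately show False
      using one_pair_contradiction_asym[OF b f, of y x v1 v2] xy sh x v1 v2 lt rest by (simp only: eq) blast
  qed
qed

end

context ground
begin

text \<open>In the second round of shifting only the bounds on pairs meeting \<open>{x, y, u, v}\<close> are maintained, while degrees may
  grow. A shift \<open>j \<mapsto> i\<close> that breaks one of them makes almost all members contain \<open>i\<close>, hence before the shift almost all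
  members hit \<open>{i, j}\<close>; then \<open>{x, y}\<close> is hit too often for the pair bounds.\<close>

lemma pair_overfull:
  assumes fam: "fam \<F>" and f: "35 * M \<le> real (card \<F>)"
    and d: "s \<in> X" "a \<in> X" "b \<in> X" "w \<in> X" "s \<noteq> w" "a \<noteq> w" "b \<noteq> w"
    and ab: "real (card \<F>) < 2 * cnt \<F> (\<lambda>F. a \<in> F \<or> b \<in> F)"
    and p: "cnt \<F> (\<lambda>F. s \<in> F \<and> a \<in> F) \<le> 11 / 5 * M" "cnt \<F> (\<lambda>F. s \<in> F \<and> b \<in> F) \<le> 11 / 5 * M"
    and sw: "11 / 5 * M < cnt \<F> (\<lambda>F. s \<in> F \<and> w \<in> F)"
  shows "cnt \<F> (\<lambda>F. w \<notin> F) \<le> 23 / 5 * M"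
proof -
  have nsw: "cnt \<F> (\<lambda>F. s \<notin> F \<and> w \<notin> F) \<le> 6 / 5 * M"
    using pair_dichotomy[OF fam d(1) d(4) d(5)] sw by linarith
  \<comment> \<open>The pairs form a chain: \<open>s\<close> with \<open>w\<close> is frequent, so
    few members avoid both; hence most members through \<open>c\<close> contain \<open>w\<close>,
    that pair is frequent too, and few members avoid \<open>c\<close> and \<open>w\<close>. In total
    2.2 + 1.2 + 1.2 = 23 / 5. One of \<open>a\<close>, \<open>b\<close> can serve as
    \<open>c\<close>, having at least half of the hits of \<open>{a, b}\<close>.\<close>
  have main: ?thesis if c: "c \<in> X" "c \<noteq> w" "cnt \<F> (\<lambda>F. s \<in> F \<and> c \<in> F) \<le> 11 / 5 * M" "35 / 4 * M < cnt \<F> (\<lambda>F. c \<in> F)" for c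
  proof -
    have "cnt \<F> (\<lambda>F. c \<in> F) \<le> cnt \<F> (\<lambda>F. s \<in> F \<and> c \<in> F) + (cnt \<F> (\<lambda>F. s \<notin> F \<and> w \<notin> F) + cnt \<F> (\<lambda>F. c \<in> F \<and> w \<in> F))"
      using cnt_le_sum_list[of \<F> "\<lambda>F. c \<in> F" "[\<lambda>F. s \<in> F \<and> c \<in> F, \<lambda>F. s \<notin> F \<and> w \<notin> F, \<lambda>F. c \<in> F \<and> w \<in> F]"] by force
    then have "11 / 5 * M < cnt \<F> (\<lambda>F. c \<in> F \<and> w \<in> F)" using c nsw M_pos by linarith
    then have "cnt \<F> (\<lambda>F. c \<notin> F \<and> w \<notin> F) \<le> 6 / 5 * M"
      using pair_dichotomy[OF fam c(1) d(4) c(2)] by linarith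
    moreover have "cnt \<F> (\<lambda>F. w \<notin> F) \<le> cnt \<F> (\<lambda>F. s \<in> F \<and> c \<in> F) + (cnt \<F> (\<lambda>F. s \<notin> F \<and> w \<notin> F) + cnt \<F> (\<lambda>F. c \<notin> F \<and> w \<notin> F))"
      using cnt_le_sum_list[of \<F> "\<lambda>F. w \<notin> F" "[\<lambda>F. s \<in> F \<and> c \<in> F, \<lambda>F. s \<notin> F \<and> w \<notin> F, \<lambda>F. c \<notin> F \<and> w \<notin> F]"] by force
    ultimately show ?thesis using c nsw by linarith
  qed
  have "cnt \<F> (\<lambda>F. a \<in> F \<or> b \<in> F) \<le> cnt \<F> (\<lambda>F. a \<in> F) + cnt \<F> (\<lambda>F. b \<in> F)"
    using cnt_le_sum_list[of \<F> "\<lambda>F. a \<in> F \<or> b \<in> F" "[\<lambda>F. a \<in> F, \<lambda>F. b \<in> F]"] by force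
  then have "35 / 4 * M < cnt \<F> (\<lambda>F. a \<in> F) \<or> 35 / 4 * M < cnt \<F> (\<lambda>F. b \<in> F)" using f ab by linarith
  then show ?thesis using main[of a] main[of b] d p by blast
qed

text \<open>A member hitting \<open>{u, v}\<close> contains one of the seven pairs with an end in
  \<open>{u, v}\<close> or has trace \<open>{u}\<close> or \<open>{v}\<close>. The sum 7 * 2.2 + 2 *
  1.02 = 872 / 50 is just below 35 / 2.\<close>

lemma hits_pair_le:
  assumes p: "\<And>s w. s \<in> {x, y, u, v} \<Longrightarrow> w \<in> X \<Longrightarrow> s \<noteq> w \<Longrightarrow> cnt \<F> (\<lambda>F. s \<in> F \<and> w \<in> F) \<le> 11 / 5 * M"
    and d: "x \<in> X" "y \<in> X" "u \<in> X" "v \<in> X" "c \<in> X" "distinct [x, y, u, v, c]"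
    and n: "cnt \<F> (\<lambda>F. F \<inter> {x, y, u, v, c} = {u}) \<le> 51 / 50 * M" "cnt \<F> (\<lambda>F. F \<inter> {x, y, u, v, c} = {v}) \<le> 51 / 50 * M"
  shows "cnt \<F> (\<lambda>F. u \<in> F \<or> v \<in> F) \<le> 872 / 50 * M"
proof -
  let ?p = "\<lambda>a b. cnt \<F> (\<lambda>F. a \<in> F \<and> b \<in> F)"
  let ?U = "{x, y, u, v, c}"
  have "cnt \<F> (\<lambda>F. u \<in> F \<or> v \<in> F) \<le> ?p u v + (?p u x + (?p u y + (?p u c + (?p v x + (?p v y + (?p v c +
     (cnt \<F> (\<lambda>F. F \<inter> ?U = {u}) + cnt \<F> (\<lambda>F. F \<inter> ?U = {v}))))))))"
    using cnt_le_sum_list[of \<F> "\<lambda>F. u \<in> F \<or> v \<in> F" "[\<lambda>F. u \<in> F \<and> v \<in> F, \<lambda>F. u \<in> F \<and> x \<in> F, \<lambda>F. u \<in> F \<and> y \<in> F,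
       \<lambda>F. u \<in> F \<and> c \<in> F, \<lambda>F. v \<in> F \<and> x \<in> F, \<lambda>F. v \<in> F \<and> y \<in> F, \<lambda>F. v \<in> F \<and> c \<in> F,
       \<lambda>F. F \<inter> ?U = {u}, \<lambda>F. F \<inter> ?U = {v}]"] by force
  moreover have "?p u v \<le> 11 / 5 * M" "?p u x \<le> 11 / 5 * M" "?p u y \<le> 11 / 5 * M" "?p u c \<le> 11 / 5 * M"
    "?p v x \<le> 11 / 5 * M" "?p v y \<le> 11 / 5 * M" "?p v c \<le> 11 / 5 * M"
    by (rule p; use d in auto)+
  ultimately show ?thesis using n by linarith
qed

lemma two_pairs_contradiction:
  assumes bal: "balanced \<F>" and f: "35 * M \<le> real (card \<F>)"
    and d: "x \<in> X" "y \<in> X" "u \<in> X" "v \<in> X" "distinct [x, y, u, v]"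
    and xy: "real (card \<F>) < 2 * cnt \<F> (\<lambda>F. x \<in> F \<or> y \<in> F)"
    and uv: "real (card \<F>) < 2 * cnt \<F> (\<lambda>F. u \<in> F \<or> v \<in> F)"
  shows False
proof -
  let ?U = "{x, y, u, v}"
  define R where "R \<G> \<longleftrightarrow> fam \<G> \<and> card \<G> = card \<F> \<and> real (card \<F>) < 2 * cnt \<G> (\<lambda>F. x \<in> F \<or> y \<in> F)
    \<and> real (card \<F>) < 2 * cnt \<G> (\<lambda>F. u \<in> F \<or> v \<in> F)" for \<G>
  define Q where "Q \<G> \<longleftrightarrow> R \<G> \<and> (\<forall>s\<in>?U. \<forall>w\<in>X. s \<noteq> w \<longrightarrow> cnt \<G> (\<lambda>F. s \<in> F \<and> w \<in> F) \<le> 11 / 5 * M)" for \<G>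
  have Q0: "Q \<F>" using bal xy uv d balanced_pair[OF bal] by (auto simp: Q_def R_def balanced_def)
  have finQ: "finite \<G> \<and> (\<forall>F\<in>\<G>. finite F)" if "Q \<G>" for \<G>
    using that fam_finite fam_mem by (auto simp: Q_def R_def)
  show False
  proof (rule shift_ad_extremis[of Q \<F> "X - ?U"])
    fix \<G> assume Q: "Q \<G>" and sh: "shifted_on (X - ?U) \<G>"
    have fam: "fam \<G>" and hits: "real (card \<F>) < 2 * cnt \<G> (\<lambda>F. x \<in> F \<or> y \<in> F)" "real (card \<F>) < 2 * cnt \<G> (\<lambda>F. u \<in> F \<or> v \<in> F)"
      using Q by (auto simp: Q_def R_def)
    have p: "cnt \<G> (\<lambda>F. s \<in> F \<and> w \<in> F) \<le> 11 / 5 * M" if "s \<in> ?U" "w \<in> X" "s \<noteq> w" for s w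
      using Q that unfolding Q_def by blast
    have cV: "card (X - ?U) \<ge> 1" using d cardX k3 finX by (subst card_Diff_subset) auto
    define c where "c = Min (X - ?U)"
    have "X - ?U \<noteq> {}" using cV by (metis card.empty not_one_le_zero)
    then have c: "c \<in> X - ?U" "\<And>w. w \<in> X - ?U \<Longrightarrow> c \<le> w"
      using finX unfolding c_def by (meson Min_in finite_Diff, meson Min_le finite_Diff)
    let ?W = "{x, y, u, v, c}"
    have W: "?W \<subseteq> X" "card ?W = 5" using d c by auto
    have XW: "X - ?W \<subseteq> X - ?U" by auto
    have alt: "cnt \<G> (\<lambda>F. F \<inter> ?W = {s}) \<le> 51 / 50 * M \<or> cnt \<G> (\<lambda>F. F \<inter> ?W = {t}) \<le> 51 / 50 * M"
      if "s \<in> ?U" "t \<in> ?U" "s \<noteq> t" for s t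
      unfolding M_def
    proof (rule link_1_shifted_bound[OF finX cardX k3 _ _ sh XW W(1) _ _ c(1)])
      show "c < w" if "w \<in> X - ?W" for w using c(2)[of w] that by auto
      show "c \<noteq> s" "c \<noteq> t" using that c by auto
    qed (use fam W that in auto)
    have dW: "distinct [x, y, u, v, c]" "distinct [u, v, x, y, c]" using d c by auto
    have perm: "{u, v, x, y, c} = ?W" "{u, v, x, y} = ?U" by auto
    \<comment> \<open>At most one of the four single traces is frequent, so one of the two pairs has
      none.\<close>
    have "(cnt \<G> (\<lambda>F. F \<inter> ?W = {u}) \<le> 51 / 50 * M \<and> cnt \<G> (\<lambda>F. F \<inter> ?W = {v}) \<le> 51 / 50 * M) \<or>
      (cnt \<G> (\<lambda>F. F \<inter> ?W = {x}) \<le> 51 / 50 * M \<and> cnt \<G> (\<lambda>F. F \<inter> ?W = {y}) \<le> 51 / 50 * M)"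
      using alt[of x u] alt[of x v] alt[of y u] alt[of y v] d by auto
    then show False
    proof
      assume n: "cnt \<G> (\<lambda>F. F \<inter> ?W = {u}) \<le> 51 / 50 * M \<and> cnt \<G> (\<lambda>F. F \<inter> ?W = {v}) \<le> 51 / 50 * M"
      have "cnt \<G> (\<lambda>F. u \<in> F \<or> v \<in> F) \<le> 872 / 50 * M"
        by (rule hits_pair_le[of x y u v _ c]) (use p d c dW n in auto)
      then show False using hits f M_pos by linarith
    next
      assume n: "cnt \<G> (\<lambda>F. F \<inter> ?W = {x}) \<le> 51 / 50 * M \<and> cnt \<G> (\<lambda>F. F \<inter> ?W = {y}) \<le> 51 / 50 * M"
      have "cnt \<G> (\<lambda>F. x \<in> F \<or> y \<in> F) \<le> 872 / 50 * M"
        by (rule hits_pair_le[of u v x y _ c]) (use p d c dW n perm in auto)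
      then show False using hits f M_pos by linarith
    qed
  next
    fix \<G> i j assume Q: "Q \<G>" and ij: "i \<in> X - ?U" "j \<in> X - ?U" "i < j" and nQ: "\<not> Q (shift i j \<G>)"
    let ?H = "shift i j \<G>"
    have R: "R \<G>" using Q by (simp add: Q_def)
    have inv: "cnt ?H (\<lambda>F. x \<in> F \<or> y \<in> F) = cnt \<G> (\<lambda>F. x \<in> F \<or> y \<in> F)" "cnt ?H (\<lambda>F. u \<in> F \<or> v \<in> F) = cnt \<G> (\<lambda>F. u \<in> F \<or> v \<in> F)"
      by (rule cnt_shift; use ij in auto)+
    have RH: "R ?H" using R ij fam_shift inv by (auto simp: R_def card_shift)
    then obtain s w where sw: "s \<in> ?U" "w \<in> X" "s \<noteq> w" and big: "11 / 5 * M < cnt ?H (\<lambda>F. s \<in> F \<and> w \<in> F)"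
      using nQ unfolding Q_def by (meson not_le)
    have p: "cnt \<G> (\<lambda>F. s \<in> F \<and> w \<in> F) \<le> 11 / 5 * M" if "s \<in> ?U" "w \<in> X" "s \<noteq> w" for s w
      using Q that unfolding Q_def by blast
    have pinv: "cnt ?H (\<lambda>F. s \<in> F \<and> w \<in> F) = cnt \<G> (\<lambda>F. s \<in> F \<and> w \<in> F)" if "s \<notin> {i, j}" "w \<notin> {i, j}" for s w
      by (rule cnt_shift) (use that in auto)
    have w: "w \<in> {i, j}"
    proof (rule ccontr)
      assume "w \<notin> {i, j}"
      then show False using pinv[of s w] p[OF sw] big sw ij by auto
    qed
    \<comment> \<open>Here \<open>s\<close> and \<open>s'\<close> form one hitting pair and
      \<open>a\<close>, \<open>b\<close> the other. Before the shift at most 23 / 5 \<open>M\<close>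
      members avoid \<open>i\<close> and \<open>j\<close>; any other member hitting
      \<open>{s, s'}\<close> contains one of four bounded pairs, and 4.6 + 4 * 2.2 < 17.5.\<close>
    have fin: False
      if U: "s \<in> ?U" "s' \<in> ?U" "a \<in> ?U" "b \<in> ?U" "s \<noteq> a" "s \<noteq> b"
        and h: "real (card \<F>) < 2 * cnt ?H (\<lambda>F. s \<in> F \<or> s' \<in> F)" "real (card \<F>) < 2 * cnt ?H (\<lambda>F. a \<in> F \<or> b \<in> F)"
        and big: "11 / 5 * M < cnt ?H (\<lambda>F. s \<in> F \<and> w \<in> F)" for s s' a b
    proof -
      have nU: "i \<notin> ?U" "j \<notin> ?U" "w \<notin> ?U" using ij w by auto
      have UX: "s \<in> X" "s' \<in> X" "a \<in> X" "b \<in> X" using U d by auto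
      have H: "fam ?H" "card ?H = card \<F>" using RH by (auto simp: R_def)
      have neq: "s \<noteq> w" "a \<noteq> w" "b \<noteq> w" "s \<notin> {i, j}" "s' \<notin> {i, j}" "a \<notin> {i, j}" "b \<notin> {i, j}" using U nU by auto
      have "cnt ?H (\<lambda>F. w \<notin> F) \<le> 23 / 5 * M"
      proof (rule pair_overfull[OF H(1) _ UX(1) UX(3) UX(4) sw(2) neq(1-3) _ _ _ big])
        show "cnt ?H (\<lambda>F. s \<in> F \<and> a \<in> F) \<le> 11 / 5 * M" "cnt ?H (\<lambda>F. s \<in> F \<and> b \<in> F) \<le> 11 / 5 * M"
          using pinv neq p U UX by auto
      qed (use H f h in auto)
      moreover have "cnt ?H (\<lambda>F. i \<notin> F \<and> j \<notin> F) \<le> cnt ?H (\<lambda>F. w \<notin> F)" by (rule cnt_mono) (use w in auto)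
      moreover have "cnt ?H (\<lambda>F. i \<notin> F \<and> j \<notin> F) = cnt \<G> (\<lambda>F. i \<notin> F \<and> j \<notin> F)" by (rule cnt_shift) auto
      moreover have "cnt ?H (\<lambda>F. s \<in> F \<or> s' \<in> F) = cnt \<G> (\<lambda>F. s \<in> F \<or> s' \<in> F)" by (rule cnt_shift) (use neq in auto)
      moreover have "cnt \<G> (\<lambda>F. s \<in> F \<or> s' \<in> F) \<le> cnt \<G> (\<lambda>F. i \<notin> F \<and> j \<notin> F) + (cnt \<G> (\<lambda>F. s \<in> F \<and> i \<in> F) +
         (cnt \<G> (\<lambda>F. s \<in> F \<and> j \<in> F) + (cnt \<G> (\<lambda>F. s' \<in> F \<and> i \<in> F) + cnt \<G> (\<lambda>F. s' \<in> F \<and> j \<in> F))))"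
        using cnt_le_sum_list[of \<G> "\<lambda>F. s \<in> F \<or> s' \<in> F" "[\<lambda>F. i \<notin> F \<and> j \<notin> F, \<lambda>F. s \<in> F \<and> i \<in> F, \<lambda>F. s \<in> F \<and> j \<in> F,
          \<lambda>F. s' \<in> F \<and> i \<in> F, \<lambda>F. s' \<in> F \<and> j \<in> F]"] by force
      moreover have "cnt \<G> (\<lambda>F. s \<in> F \<and> i \<in> F) \<le> 11 / 5 * M" "cnt \<G> (\<lambda>F. s \<in> F \<and> j \<in> F) \<le> 11 / 5 * M"
        "cnt \<G> (\<lambda>F. s' \<in> F \<and> i \<in> F) \<le> 11 / 5 * M" "cnt \<G> (\<lambda>F. s' \<in> F \<and> j \<in> F) \<le> 11 / 5 * M"
        using p U neq ij by auto
      ultimately show False using h f M_pos by linarith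
    qed
    have hH: "real (card \<F>) < 2 * cnt ?H (\<lambda>F. x \<in> F \<or> y \<in> F)" "real (card \<F>) < 2 * cnt ?H (\<lambda>F. u \<in> F \<or> v \<in> F)"
      using RH by (auto simp: R_def)
    have hH': "real (card \<F>) < 2 * cnt ?H (\<lambda>F. y \<in> F \<or> x \<in> F)" "real (card \<F>) < 2 * cnt ?H (\<lambda>F. v \<in> F \<or> u \<in> F)"
      using hH by (simp_all add: disj_commute)
    from sw(1) show False
      using fin[of x y u v] fin[of y x u v] fin[of u v x y] fin[of v u x y] hH hH' big d by auto
  qed (use Q0 finQ in auto)
qed

lemma degree_more_than_half:
  assumes fam: "fam \<F>" and f: "35 * M \<le> real (card \<F>)"
  shows "\<exists>x\<in>X. real (card \<F>) < 2 * cnt \<F> (\<lambda>F. x \<in> F)"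
proof (rule ccontr)
  assume "\<not> ?thesis"
  then have b: "balanced \<F>" using fam by (auto simp: balanced_def not_less)
  have ne: "\<F> \<noteq> {}" using f M_pos by auto
  obtain \<G> x y where G: "balanced \<G>" "card \<G> = card \<F>" and xy: "x \<in> X" "y \<in> X" "x \<noteq> y"
    "real (card \<F>) < 2 * cnt \<G> (\<lambda>F. x \<in> F \<or> y \<in> F)"
    using hitting_pair_exists[OF b ne] by blast
  have h: "real (card \<G>) < 2 * cnt \<G> (\<lambda>F. x \<in> F \<or> y \<in> F)" using xy G by simp
  from G(1) h show False
  proof (cases rule: second_hitting_pair)
    case (shifted \<H>)
    then show False using one_pair_contradiction[of \<H> x y] f G xy by auto
  next
    case (pair \<H> u v)
    then show False using two_pairs_contradiction[of \<H> x y u v] f G xy by auto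
  qed
qed

end

subsection \<open>The spectral gap of the disjointness matrix\<close>

lemma card_subsets_through:
  assumes "finite V" "x \<in> V" "b \<ge> 1"
  shows "card {B \<in> subsets_of_size V b. x \<in> B} = (card V - 1 choose (b - 1))"
proof -
  have "{B \<in> subsets_of_size V b. x \<in> B} = {B. B \<subseteq> V \<and> card B = b \<and> {x} \<subseteq> B}" by (auto simp: subsets_of_size_def)
  then show ?thesis using card_supersets[of V "{x}" 1 b] assms by simp
qed

lemma subsets_avoiding: "{B \<in> subsets_of_size V b. x \<notin> B} = subsets_of_size (V - {x}) b"
  by (auto simp: subsets_of_size_def)

lemma card_subsets_through_avoiding:
  assumes "finite V" "x \<in> V" "y \<in> V" "x \<noteq> y" "b \<ge> 1"
  shows "card {B \<in> subsets_of_size V b. x \<in> B \<and> y \<notin> B} = (card V - 2 choose (b - 1))"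
proof -
  have "{B \<in> subsets_of_size V b. x \<in> B \<and> y \<notin> B} = {B \<in> subsets_of_size (V - {y}) b. x \<in> B}"
    by (auto simp: subsets_of_size_def)
  then show ?thesis using card_subsets_through[of "V - {y}" x b] assms by (simp add: numeral_2_eq_2)
qed

lemma finite_subsets_mem: "finite V \<Longrightarrow> B \<in> subsets_of_size V b \<Longrightarrow> finite B"
  by (auto simp: subsets_of_size_def intro: finite_subset)

lemma sum_swap_point:
  assumes V: "finite V"
  shows "(\<Sum>x\<in>V. \<Sum>B\<in>{B \<in> subsets_of_size V b. x \<in> B}. (\<phi> x B :: real)) = (\<Sum>B\<in>subsets_of_size V b. \<Sum>x\<in>B. \<phi> x B)"
proof -
  have fS: "finite (subsets_of_size V b)" using V by (rule finite_subsets_of_size)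
  have "(\<Sum>x\<in>V. \<Sum>B\<in>{B \<in> subsets_of_size V b. x \<in> B}. \<phi> x B) = (\<Sum>B\<in>subsets_of_size V b. \<Sum>x\<in>{x \<in> V. x \<in> B}. \<phi> x B)"
    by (rule sum.swap_restrict[OF V fS])
  also have "\<dots> = (\<Sum>B\<in>subsets_of_size V b. \<Sum>x\<in>B. \<phi> x B)"
    by (intro sum.cong) (auto simp: subsets_of_size_def)
  finally show ?thesis .
qed

text \<open>Bessel's inequality: \<open>h\<close> divided by the binomial is the orthogonal
  projection of \<open>g\<close> to the functions that sum zero-sum point weights over
  \<open>B\<close>.\<close>

lemma level_one_bound:
  fixes g :: "nat set \<Rightarrow> real"
  assumes V: "finite V" and b: "b \<ge> 1" "b < card V" and g0: "(\<Sum>B\<in>subsets_of_size V b. g B) = 0"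
  shows "(\<Sum>x\<in>V. (\<Sum>B\<in>{B \<in> subsets_of_size V b. x \<in> B}. g B)\<^sup>2) \<le> real (card V - 2 choose (b - 1)) * (\<Sum>B\<in>subsets_of_size V b. (g B)\<^sup>2)"
proof -
  let ?S = "subsets_of_size V b"
  let ?C = "real (card V - 2 choose (b - 1))"
  define s where "s x = (\<Sum>B\<in>{B \<in> ?S. x \<in> B}. g B)" for x
  define h where "h B = (\<Sum>x\<in>B. s x)" for B
  have fS: "finite ?S" using V by (rule finite_subsets_of_size)
  have C: "?C > 0" using b by simp
  have s0: "(\<Sum>x\<in>V. s x) = 0"
  proof -
    have "(\<Sum>x\<in>V. s x) = (\<Sum>B\<in>?S. \<Sum>x\<in>B. g B)" unfolding s_def by (rule sum_swap_point[OF V])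
    also have "\<dots> = (\<Sum>B\<in>?S. real b * g B)" by (intro sum.cong) (auto simp: subsets_of_size_def)
    also have "\<dots> = 0" using g0 by (simp add: sum_distrib_left[symmetric])
    finally show ?thesis .
  qed
  have gh: "(\<Sum>B\<in>?S. g B * h B) = (\<Sum>x\<in>V. (s x)\<^sup>2)"
  proof -
    have "(\<Sum>B\<in>?S. g B * h B) = (\<Sum>B\<in>?S. \<Sum>x\<in>B. s x * g B)"
      by (simp add: h_def sum_distrib_left mult.commute)
    also have "\<dots> = (\<Sum>x\<in>V. \<Sum>B\<in>{B \<in> ?S. x \<in> B}. s x * g B)" by (rule sum_swap_point[OF V, symmetric])
    also have "\<dots> = (\<Sum>x\<in>V. s x * s x)" by (simp only: s_def sum_distrib_left)
    finally show ?thesis by (simp add: power2_eq_square)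
  qed
  have hh: "(\<Sum>B\<in>?S. (h B)\<^sup>2) = ?C * (\<Sum>x\<in>V. (s x)\<^sup>2)"
  proof -
    have "(\<Sum>B\<in>?S. (h B)\<^sup>2) = (\<Sum>B\<in>?S. \<Sum>x\<in>B. s x * h B)"
      by (simp add: h_def power2_eq_square sum_distrib_right)
    also have "\<dots> = (\<Sum>x\<in>V. \<Sum>B\<in>{B \<in> ?S. x \<in> B}. s x * h B)" by (rule sum_swap_point[OF V, symmetric])
    also have "\<dots> = (\<Sum>x\<in>V. s x * (\<Sum>B\<in>{B \<in> ?S. x \<in> B}. h B))" by (simp only: sum_distrib_left)
    also have "\<dots> = (\<Sum>x\<in>V. s x * (?C * s x))"
    proof (intro sum.cong refl)
      fix x assume x: "x \<in> V"
      let ?Sx = "{B \<in> ?S. x \<in> B}"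
      have "(\<Sum>B\<in>?Sx. h B) = (\<Sum>B\<in>?Sx. \<Sum>y\<in>V. (if y \<in> B then s y else 0))"
      proof (intro sum.cong refl)
        fix B assume "B \<in> ?Sx"
        then have "V \<inter> B = B" by (auto simp: subsets_of_size_def)
        then show "h B = (\<Sum>y\<in>V. (if y \<in> B then s y else 0))"
          unfolding h_def using sum.inter_restrict[OF V, of s B] by simp
      qed
      \<comment> \<open>As all \<open>s y\<close> sum to zero, the sum over \<open>B\<close> is
        minus the sum over its complement, and every y other than \<open>x\<close> is missed by the
        same number of sets through \<open>x\<close>.\<close>
      also have "\<dots> = (\<Sum>B\<in>?Sx. \<Sum>y\<in>V. s y) - (\<Sum>B\<in>?Sx. \<Sum>y\<in>V. (if y \<notin> B then s y else 0))"
        by (simp only: sum_subtractf[symmetric]) (auto intro!: sum.cong)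
      also have "\<dots> = - (\<Sum>y\<in>V. \<Sum>B\<in>?Sx. (if y \<notin> B then s y else 0))"
        using s0 by (simp add: sum.swap[of _ V ?Sx])
      also have "(\<Sum>y\<in>V. \<Sum>B\<in>?Sx. (if y \<notin> B then s y else 0)) = (\<Sum>y\<in>V. (if y = x then 0 else ?C * s y))"
      proof (intro sum.cong refl)
        fix y assume y: "y \<in> V"
        have "(\<Sum>B\<in>?Sx. (if y \<notin> B then s y else 0)) = real (card {B \<in> ?S. x \<in> B \<and> y \<notin> B}) * s y"
          using fS by (simp add: sum.If_cases Int_def conj_assoc)
        also have "\<dots> = (if y = x then 0 else ?C * s y)"
          using card_subsets_through_avoiding[OF V x y _ b(1)] by auto
        finally show "(\<Sum>B\<in>?Sx. (if y \<notin> B then s y else 0)) = (if y = x then 0 else ?C * s y)" .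
      qed
      also have "\<dots> = (\<Sum>y\<in>V. ?C * s y) - (\<Sum>y\<in>V. (if y = x then ?C * s y else 0))"
        by (simp only: sum_subtractf[symmetric]) (auto intro!: sum.cong)
      also have "\<dots> = - (?C * s x)" using s0 V x by (simp add: sum_distrib_left[symmetric])
      finally show "s x * (\<Sum>B\<in>?Sx. h B) = s x * (?C * s x)" by simp
    qed
    also have "\<dots> = ?C * (\<Sum>x\<in>V. (s x)\<^sup>2)"
      unfolding sum_distrib_left by (rule sum.cong) (auto simp: power2_eq_square)
    finally show ?thesis .
  qed
  have "0 \<le> (\<Sum>B\<in>?S. (?C * g B - h B)\<^sup>2)" by (simp add: sum_nonneg)
  also have "\<dots> = ?C\<^sup>2 * (\<Sum>B\<in>?S. (g B)\<^sup>2) - 2 * ?C * (\<Sum>B\<in>?S. g B * h B) + (\<Sum>B\<in>?S. (h B)\<^sup>2)"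
    unfolding sum_distrib_left sum_subtractf[symmetric] sum.distrib[symmetric]
    by (rule sum.cong) (auto simp: power2_eq_square algebra_simps)
  also have "\<dots> = ?C * (?C * (\<Sum>B\<in>?S. (g B)\<^sup>2) - (\<Sum>x\<in>V. (s x)\<^sup>2))"
    unfolding gh hh by (simp add: algebra_simps power2_eq_square)
  finally have "(\<Sum>x\<in>V. (s x)\<^sup>2) \<le> ?C * (\<Sum>B\<in>?S. (g B)\<^sup>2)"
    using C by (simp add: zero_le_mult_iff)
  then show ?thesis by (simp add: s_def)
qed

text \<open>Removing one point of \<open>A\<close> in all possible ways drives the induction on the
  size of \<open>A\<close>.\<close>

lemma sum_subsets_Suc:
  assumes V: "finite V"
  shows "real (Suc a) * (\<Sum>A\<in>subsets_of_size V (Suc a). (\<phi> A :: real)) = (\<Sum>x\<in>V. \<Sum>A\<in>subsets_of_size (V - {x}) a. \<phi> (insert x A))"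
proof -
  have "real (Suc a) * (\<Sum>A\<in>subsets_of_size V (Suc a). \<phi> A) = (\<Sum>A\<in>subsets_of_size V (Suc a). \<Sum>x\<in>A. \<phi> A)"
    unfolding sum_distrib_left by (intro sum.cong) (auto simp: subsets_of_size_def)
  also have "\<dots> = (\<Sum>x\<in>V. \<Sum>A\<in>{A \<in> subsets_of_size V (Suc a). x \<in> A}. \<phi> A)" by (rule sum_swap_point[OF V, symmetric])
  also have "\<dots> = (\<Sum>x\<in>V. \<Sum>A\<in>subsets_of_size (V - {x}) a. \<phi> (insert x A))"
  proof (rule sum.cong[OF refl])
    fix x assume x: "x \<in> V"
    show "(\<Sum>A\<in>{A \<in> subsets_of_size V (Suc a). x \<in> A}. \<phi> A) = (\<Sum>A\<in>subsets_of_size (V - {x}) a. \<phi> (insert x A))"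
    proof (rule sum.reindex_bij_witness[of _ "insert x" "\<lambda>A. A - {x}"])
      fix A assume A: "A \<in> subsets_of_size (V - {x}) a"
      then have "finite A" "x \<notin> A" using V by (auto simp: subsets_of_size_def intro: finite_subset)
      then show "insert x A \<in> {A \<in> subsets_of_size V (Suc a). x \<in> A}" using A x by (auto simp: subsets_of_size_def)
      show "insert x A - {x} = A" using \<open>x \<notin> A\<close> by auto
    next
      fix A assume A: "A \<in> {A \<in> subsets_of_size V (Suc a). x \<in> A}"
      then have "finite A" using V by (auto simp: subsets_of_size_def intro: finite_subset)
      then show "A - {x} \<in> subsets_of_size (V - {x}) a" using A by (auto simp: subsets_of_size_def card_Diff_singleton)
      show "insert x (A - {x}) = A" using A by auto
      then show "\<phi> (insert x (A - {x})) = \<phi> A" by simp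
    qed
  qed
  finally show ?thesis .
qed

text \<open>The weight does not depend on \<open>B\<close>, so for a zero-sum \<open>g\<close> the
  result is zero; this removes the mixed term of a square below.\<close>

lemma sum_disjoint_pairs:
  assumes V: "finite V"
  shows "(\<Sum>A\<in>subsets_of_size V a. \<Sum>B\<in>subsets_of_size (V - A) b. (g B :: real)) = (\<Sum>B\<in>subsets_of_size V b. real (card V - b choose a) * g B)"
proof -
  have "(\<Sum>A\<in>subsets_of_size V a. \<Sum>B\<in>subsets_of_size (V - A) b. g B) = (\<Sum>A\<in>subsets_of_size V a. \<Sum>B\<in>{B \<in> subsets_of_size V b. A \<inter> B = {}}. g B)"
    by (intro sum.cong refl) (auto simp: subsets_of_size_def)
  also have "\<dots> = (\<Sum>B\<in>subsets_of_size V b. \<Sum>A\<in>{A \<in> subsets_of_size V a. A \<inter> B = {}}. g B)"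
    by (rule sum.swap_restrict) (use finite_subsets_of_size[OF V] in auto)
  also have "\<dots> = (\<Sum>B\<in>subsets_of_size V b. real (card V - b choose a) * g B)"
  proof (intro sum.cong refl)
    fix B assume B: "B \<in> subsets_of_size V b"
    have "{A \<in> subsets_of_size V a. A \<inter> B = {}} = subsets_of_size (V - B) a" by (auto simp: subsets_of_size_def)
    moreover have "card (V - B) = card V - b" using B V finite_subsets_mem[OF V B] by (auto simp: subsets_of_size_def card_Diff_subset)
    ultimately show "(\<Sum>A\<in>{A \<in> subsets_of_size V a. A \<inter> B = {}}. g B) = real (card V - b choose a) * g B"
      using V by (simp add: card_subsets_of_size)
  qed
  finally show ?thesis .
qed

text \<open>The right-hand side is the square of the second singular value of the disjointness matrix.\<close>

lemma disjointness_spectral_bound: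
  fixes g :: "nat set \<Rightarrow> real"
  assumes "finite V" "b \<ge> 1" "Suc a + b \<le> card V" "(\<Sum>B\<in>subsets_of_size V b. g B) = 0"
  shows "(\<Sum>A\<in>subsets_of_size V (Suc a). (\<Sum>B\<in>subsets_of_size (V - A) b. g B)\<^sup>2)
    \<le> real (card V - a - 2 choose (b - 1)) * real (card V - b - 1 choose a) * (\<Sum>B\<in>subsets_of_size V b. (g B)\<^sup>2)"
  using assms
proof (induction a arbitrary: V g)
  case 0
  note V = \<open>finite V\<close>
  have "(\<Sum>A\<in>subsets_of_size V (Suc 0). (\<Sum>B\<in>subsets_of_size (V - A) b. g B)\<^sup>2) = (\<Sum>x\<in>V. (\<Sum>B\<in>subsets_of_size (V - {x}) b. g B)\<^sup>2)"
  proof -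
    have "subsets_of_size (V - {x}) 0 = {{}}" for x using V by (auto simp: subsets_of_size_def dest: finite_subset[of _ "V - {x}"])
    then show ?thesis using sum_subsets_Suc[OF V, of 0 "\<lambda>A. (\<Sum>B\<in>subsets_of_size (V - A) b. g B)\<^sup>2"] by simp
  qed
  also have "\<dots> = (\<Sum>x\<in>V. (\<Sum>B\<in>{B \<in> subsets_of_size V b. x \<in> B}. g B)\<^sup>2)"
  proof (intro sum.cong refl)
    fix x
    have "(\<Sum>B\<in>subsets_of_size V b. g B) = (\<Sum>B\<in>{B \<in> subsets_of_size V b. x \<in> B}. g B) + (\<Sum>B\<in>subsets_of_size (V - {x}) b. g B)"
      unfolding subsets_avoiding[symmetric] using finite_subsets_of_size[OF V]
      by (subst sum.union_disjoint[symmetric]) (auto intro!: sum.cong)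
    then have "(\<Sum>B\<in>subsets_of_size (V - {x}) b. g B) = - (\<Sum>B\<in>{B \<in> subsets_of_size V b. x \<in> B}. g B)" using 0 by simp
    then show "(\<Sum>B\<in>subsets_of_size (V - {x}) b. g B)\<^sup>2 = (\<Sum>B\<in>{B \<in> subsets_of_size V b. x \<in> B}. g B)\<^sup>2" by simp
  qed
  also have "\<dots> \<le> real (card V - 2 choose (b - 1)) * (\<Sum>B\<in>subsets_of_size V b. (g B)\<^sup>2)"
    using 0 by (intro level_one_bound) auto
  finally show ?case by simp
next
  case (Suc a)
  note V = \<open>finite V\<close>
  define m where "m = card V"
  have m: "a + b + 2 \<le> m" using Suc.prems by (simp add: m_def)
  define N where "N = real (m - 1 choose b)"
  define c where "c = real (m - 2 - a choose b)"
  define P where "P = real (m - a - 3 choose (b - 1))"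
  define K where "K = P * real (m - b - 2 choose a)"
  define q where "q = real (m - b - 1 choose Suc a)"
  \<comment> \<open>The mean of \<open>g\<close> over the sets avoiding \<open>x\<close>; without it
    the induction hypothesis would not apply, since \<open>g\<close> restricted to these sets need
    not sum to zero.\<close>
  define gb where "gb x = (\<Sum>B\<in>subsets_of_size (V - {x}) b. g B) / N" for x
  define G where "G = (\<Sum>B\<in>subsets_of_size V b. (g B)\<^sup>2)"
  have G0: "G \<ge> 0" by (simp add: G_def sum_nonneg)
  have N: "N > 0" using m by (simp add: N_def)
  \<comment> \<open>Both sides count disjoint pairs of a \<open>Suc a\<close>-set and a
    \<open>b\<close>-set in m - 1 points.\<close>
  have tri: "real (m - 1 choose Suc a) * c = N * q"
  proof -
    have "(m - 1 choose Suc a) * (m - 1 - Suc a choose b) = (m - 1 choose b) * (m - 1 - b choose Suc a)"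
    proof -
      have "(m - 1 choose (Suc a + b)) * ((Suc a + b) choose Suc a) = (m - 1 choose Suc a) * (m - 1 - Suc a choose (Suc a + b - Suc a))"
        by (rule choose_mult) (use m in auto)
      moreover have "(m - 1 choose (Suc a + b)) * ((Suc a + b) choose b) = (m - 1 choose b) * (m - 1 - b choose (Suc a + b - b))"
        by (rule choose_mult) (use m in auto)
      moreover have "((Suc a + b) choose Suc a) = ((Suc a + b) choose b)" using binomial_symmetric[of b "Suc a + b"] by simp
      ultimately show ?thesis by simp
    qed
    then have "real ((m - 1 choose Suc a) * (m - 1 - Suc a choose b)) = real ((m - 1 choose b) * (m - 1 - b choose Suc a))" by simp
    moreover have "m - 1 - Suc a = m - 2 - a" "m - 1 - b = m - b - 1" by auto
    ultimately show ?thesis by (simp only: of_nat_mult c_def N_def q_def)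
  qed
  have step: "(\<Sum>A\<in>subsets_of_size (V - {x}) (Suc a). (\<Sum>B\<in>subsets_of_size (V - insert x A) b. g B)\<^sup>2)
     \<le> K * (\<Sum>B\<in>subsets_of_size (V - {x}) b. (g B)\<^sup>2) + (N * (q * c) - K * N) * (gb x)\<^sup>2" if x: "x \<in> V" for x
  proof -
    let ?V = "V - {x}"
    have fV: "finite ?V" and cV: "card ?V = m - 1" using V x by (auto simp: m_def)
    define g' where "g' B = g B - gb x" for B
    have gsum: "(\<Sum>B\<in>subsets_of_size ?V b. g B) = N * gb x" using N by (simp add: gb_def)
    have cN: "real (card (subsets_of_size ?V b)) = N" using fV cV by (simp add: card_subsets_of_size N_def)
    have g'0: "(\<Sum>B\<in>subsets_of_size ?V b. g' B) = 0" using gsum cN by (simp add: g'_def sum_subtractf)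
    have T: "(\<Sum>B\<in>subsets_of_size (V - insert x A) b. g B) = (\<Sum>B\<in>subsets_of_size (?V - A) b. g' B) + c * gb x" if A: "A \<in> subsets_of_size ?V (Suc a)" for A
    proof -
      have "V - insert x A = ?V - A" by auto
      moreover have "card (?V - A) = m - 2 - a" using A fV cV finite_subsets_mem[OF fV A] by (auto simp: subsets_of_size_def card_Diff_subset)
      ultimately show ?thesis using fV by (simp add: g'_def sum_subtractf card_subsets_of_size c_def)
    qed
    have "(\<Sum>A\<in>subsets_of_size ?V (Suc a). (\<Sum>B\<in>subsets_of_size (V - insert x A) b. g B)\<^sup>2)
      = (\<Sum>A\<in>subsets_of_size ?V (Suc a). ((\<Sum>B\<in>subsets_of_size (?V - A) b. g' B) + c * gb x)\<^sup>2)"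
      using T by (intro sum.cong) auto
    also have "\<dots> = (\<Sum>A\<in>subsets_of_size ?V (Suc a). (\<Sum>B\<in>subsets_of_size (?V - A) b. g' B)\<^sup>2)
       + 2 * c * gb x * (\<Sum>A\<in>subsets_of_size ?V (Suc a). \<Sum>B\<in>subsets_of_size (?V - A) b. g' B) + real (m - 1 choose Suc a) * (c * gb x)\<^sup>2"
      using fV cV by (simp add: power2_sum sum.distrib sum_distrib_left mult_ac card_subsets_of_size)
    also have "(\<Sum>A\<in>subsets_of_size ?V (Suc a). \<Sum>B\<in>subsets_of_size (?V - A) b. g' B) = 0"
      unfolding sum_disjoint_pairs[OF fV] using g'0 by (simp add: sum_distrib_left[symmetric])
    also have "(\<Sum>A\<in>subsets_of_size ?V (Suc a). (\<Sum>B\<in>subsets_of_size (?V - A) b. g' B)\<^sup>2) \<le> K * (\<Sum>B\<in>subsets_of_size ?V b. (g' B)\<^sup>2)"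
    proof -
      have "card ?V - a - 2 = m - a - 3" "card ?V - b - 1 = m - b - 2" using cV by auto
      then show ?thesis using Suc.IH[OF fV Suc.prems(2) _ g'0] cV m by (simp add: K_def P_def)
    qed
    also have "(\<Sum>B\<in>subsets_of_size ?V b. (g' B)\<^sup>2) = (\<Sum>B\<in>subsets_of_size ?V b. (g B)\<^sup>2) - N * (gb x)\<^sup>2"
    proof -
      have "(\<Sum>B\<in>subsets_of_size ?V b. (g' B)\<^sup>2) = (\<Sum>B\<in>subsets_of_size ?V b. (g B)\<^sup>2) - 2 * gb x * (\<Sum>B\<in>subsets_of_size ?V b. g B) + N * (gb x)\<^sup>2"
        using cN by (simp add: g'_def power2_diff sum.distrib sum_subtractf sum_distrib_left mult_ac)
      then show ?thesis unfolding gsum by (simp add: algebra_simps power2_eq_square)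
    qed
    also have "real (m - 1 choose Suc a) * (c * gb x)\<^sup>2 = (N * q) * c * (gb x)\<^sup>2"
      unfolding tri[symmetric] by (simp add: power2_eq_square)
    finally show ?thesis by (simp add: algebra_simps)
  qed
  have points: "(\<Sum>x\<in>V. \<Sum>B\<in>subsets_of_size (V - {x}) b. (g B)\<^sup>2) = real (m - b) * G"
  proof -
    have fS: "finite (subsets_of_size V b)" using V by (rule finite_subsets_of_size)
    have "(\<Sum>x\<in>V. \<Sum>B\<in>subsets_of_size (V - {x}) b. (g B)\<^sup>2) = (\<Sum>x\<in>V. \<Sum>B\<in>{B \<in> subsets_of_size V b. x \<notin> B}. (g B)\<^sup>2)"
      by (simp add: subsets_avoiding)
    also have "\<dots> = (\<Sum>B\<in>subsets_of_size V b. \<Sum>x\<in>{x \<in> V. x \<notin> B}. (g B)\<^sup>2)" by (rule sum.swap_restrict[OF V fS])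
    also have "\<dots> = (\<Sum>B\<in>subsets_of_size V b. real (m - b) * (g B)\<^sup>2)"
    proof (intro sum.cong refl)
      fix B assume B: "B \<in> subsets_of_size V b"
      have "{x \<in> V. x \<notin> B} = V - B" by auto
      moreover have "card (V - B) = m - b" using B V finite_subsets_mem[OF V B] by (auto simp: subsets_of_size_def card_Diff_subset m_def)
      ultimately show "(\<Sum>x\<in>{x \<in> V. x \<notin> B}. (g B)\<^sup>2) = real (m - b) * (g B)\<^sup>2" by simp
    qed
    finally show ?thesis by (simp add: G_def sum_distrib_left)
  qed
  \<comment> \<open>As \<open>g\<close> sums to zero, \<open>N * gb x\<close> is minus the sum of
    \<open>g\<close> over the sets through \<open>x\<close>, so \<open>level_one_bound\<close>
    controls the means.\<close>
  have means: "N * (\<Sum>x\<in>V. (gb x)\<^sup>2) * real (m - 1) \<le> real b * G"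
  proof -
    have "(\<Sum>x\<in>V. (N * gb x)\<^sup>2) = (\<Sum>x\<in>V. (\<Sum>B\<in>{B \<in> subsets_of_size V b. x \<in> B}. g B)\<^sup>2)"
    proof (intro sum.cong refl)
      fix x
      have "(\<Sum>B\<in>subsets_of_size V b. g B) = (\<Sum>B\<in>{B \<in> subsets_of_size V b. x \<in> B}. g B) + (\<Sum>B\<in>subsets_of_size (V - {x}) b. g B)"
        unfolding subsets_avoiding[symmetric] using finite_subsets_of_size[OF V]
        by (subst sum.union_disjoint[symmetric]) (auto intro!: sum.cong)
      then have "(\<Sum>B\<in>subsets_of_size (V - {x}) b. g B) = - (\<Sum>B\<in>{B \<in> subsets_of_size V b. x \<in> B}. g B)" using Suc.prems by simp
      then show "(N * gb x)\<^sup>2 = (\<Sum>B\<in>{B \<in> subsets_of_size V b. x \<in> B}. g B)\<^sup>2" using N by (simp add: gb_def)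
    qed
    also have "\<dots> \<le> real (m - 2 choose (b - 1)) * G"
      unfolding m_def G_def using Suc.prems by (intro level_one_bound) auto
    finally have "N * (N * (\<Sum>x\<in>V. (gb x)\<^sup>2)) \<le> real (m - 2 choose (b - 1)) * G"
      by (simp add: power_mult_distrib sum_distrib_left power2_eq_square mult_ac)
    then have "real (m - 1) * (N * (N * (\<Sum>x\<in>V. (gb x)\<^sup>2))) \<le> real (m - 1) * (real (m - 2 choose (b - 1)) * G)"
      by (rule mult_left_mono) simp
    moreover have "real (m - 1) * real (m - 2 choose (b - 1)) = real b * N"
    proof -
      have "b * (m - 1 choose b) = (m - 1) * (m - 1 - 1 choose (b - 1))" by (rule times_binomial_minus1_eq) (use Suc.prems in simp)
      then have "real (b * (m - 1 choose b)) = real ((m - 1) * (m - 2 choose (b - 1)))" by (simp add: numeral_2_eq_2)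
      then show ?thesis by (simp only: of_nat_mult N_def)
    qed
    ultimately have "N * (real (m - 1) * (N * (\<Sum>x\<in>V. (gb x)\<^sup>2))) \<le> N * (real b * G)"
      by (simp add: mult_ac)
    then show ?thesis using N by (simp add: mult_ac)
  qed
  have bc: "real b * c = real (m - 2 - a) * P"
  proof -
    have "b * (m - 2 - a choose b) = (m - 2 - a) * (m - 2 - a - 1 choose (b - 1))"
      by (rule times_binomial_minus1_eq) (use Suc.prems in simp)
    moreover have "m - 2 - a - 1 = m - a - 3" by simp
    ultimately have "real (b * (m - 2 - a choose b)) = real ((m - 2 - a) * (m - a - 3 choose (b - 1)))" by simp
    then show ?thesis by (simp only: of_nat_mult c_def P_def)
  qed
  have Kq: "real (m - b - 1) * K = real (Suc a) * q * P"
  proof -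
    have "Suc a * (m - b - 1 choose Suc a) = (m - b - 1) * (m - b - 1 - 1 choose (Suc a - 1))"
      by (rule times_binomial_minus1_eq) simp
    moreover have "m - b - 1 - 1 = m - b - 2" by simp
    ultimately have "real (Suc a * (m - b - 1 choose Suc a)) = real ((m - b - 1) * (m - b - 2 choose a))" by simp
    then have "real (Suc a) * q = real (m - b - 1) * real (m - b - 2 choose a)" by (simp only: of_nat_mult q_def)
    then show ?thesis by (simp add: K_def mult_ac)
  qed
  \<comment> \<open>This makes the coefficient of the means nonnegative, so that the upper bound
    \<open>means\<close> may be inserted.\<close>
  have Kle: "K \<le> q * c"
  proof -
    have "m - b - 1 = Suc (m - b - 2)" "m - 2 - a = Suc (m - a - 3)" "b = Suc (b - 1)" using m Suc.prems by auto
    then have "(m - b - 2 choose a) \<le> (m - b - 1 choose Suc a)" "(m - a - 3 choose (b - 1)) \<le> (m - 2 - a choose b)"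
      by (metis binomial_Suc_Suc le_add1)+
    then have "real (m - b - 2 choose a) \<le> q" "P \<le> c" by (auto simp: q_def P_def c_def)
    then show ?thesis unfolding K_def by (subst mult.commute) (intro mult_mono, auto simp: P_def q_def)
  qed
  define S where "S = (\<Sum>A\<in>subsets_of_size V (Suc (Suc a)). (\<Sum>B\<in>subsets_of_size (V - A) b. g B)\<^sup>2)"
  have "real (Suc (Suc a)) * S = (\<Sum>x\<in>V. \<Sum>A\<in>subsets_of_size (V - {x}) (Suc a). (\<Sum>B\<in>subsets_of_size (V - insert x A) b. g B)\<^sup>2)"
    unfolding S_def by (rule sum_subsets_Suc[OF V])
  also have "\<dots> \<le> (\<Sum>x\<in>V. K * (\<Sum>B\<in>subsets_of_size (V - {x}) b. (g B)\<^sup>2) + (N * (q * c) - K * N) * (gb x)\<^sup>2)"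
    by (rule sum_mono) (rule step)
  also have "\<dots> = K * (real (m - b) * G) + (q * c - K) * (N * (\<Sum>x\<in>V. (gb x)\<^sup>2))"
    unfolding points[symmetric] sum.distrib sum_distrib_left[symmetric] by (simp add: algebra_simps)
  finally have le: "real (Suc (Suc a)) * S \<le> K * (real (m - b) * G) + (q * c - K) * (N * (\<Sum>x\<in>V. (gb x)\<^sup>2))" .
  have "real (m - 1) * (real (Suc (Suc a)) * S) \<le> real (m - 1) * (K * (real (m - b) * G) + (q * c - K) * (N * (\<Sum>x\<in>V. (gb x)\<^sup>2)))"
    by (rule mult_left_mono[OF le]) simp
  also have "\<dots> = real (m - 1) * K * real (m - b) * G + (q * c - K) * (N * (\<Sum>x\<in>V. (gb x)\<^sup>2) * real (m - 1))"
    by (simp add: algebra_simps)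
  also have "\<dots> \<le> real (m - 1) * K * real (m - b) * G + (q * c - K) * (real b * G)"
    using mult_left_mono[OF means, of "q * c - K"] Kle by simp
  also have "\<dots> = (K * (real (m - 1) * real (m - b) - real b) + q * (real b * c)) * G" by (simp add: algebra_simps)
  also have "real (m - 1) * real (m - b) - real b = real m * real (m - b - 1)"
    using m by (simp add: of_nat_diff algebra_simps)
  also have "K * (real m * real (m - b - 1)) = real m * (real (Suc a) * q * P)" using Kq by (simp add: mult_ac) 
  also have "real m * (real (Suc a) * q * P) + q * (real b * c) = real (m - 1) * (real (Suc (Suc a)) * (P * q))"
    unfolding bc using m by (simp add: of_nat_diff algebra_simps)
  finally have "(real (m - 1) * real (Suc (Suc a))) * S \<le> (real (m - 1) * real (Suc (Suc a))) * (P * q * G)" by (simp add: mult_ac)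
  then have "S \<le> P * q * G" using m by (subst (asm) mult_le_cancel_left_pos) auto
  then show ?case by (simp add: S_def P_def q_def G_def m_def numeral_3_eq_3 numeral_2_eq_2)
qed

text \<open>Subtract from the indicator of \<open>\<D>\<close> its density. A member of
  \<open>\<W>\<close> sees no set of \<open>\<D>\<close> in its complement, so there the sum of this
  function is as negative as possible, whereas its square norm shrinks with the number of sets
  missing from \<open>\<D>\<close>.\<close>

lemma cross_spectral:
  assumes V: "finite V" and W: "\<W> \<subseteq> subsets_of_size V (Suc b)" and D: "\<D> \<subseteq> subsets_of_size V b" and cr: "cross 1 \<W> \<D>"
    and b: "b \<ge> 1" "2 * b + 1 \<le> card V"
  shows "real (card \<W>) * real (card \<D>) * real (card V - b - 1)
    \<le> real b * (real (card V choose b) - real (card \<D>)) * real (card V choose b)"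
proof (cases "\<D> = {}")
  case True
  then show ?thesis by simp
next
  case False
  have fS: "finite (subsets_of_size V c)" for c using V by (rule finite_subsets_of_size)
  have fD: "finite \<D>" using D fS finite_subset by blast
  define N where "N = real (card V choose b)"
  define \<delta> where "\<delta> = real (card \<D>) / N"
  define C where "C = real (card V - b - 1 choose b)"
  have N: "N > 0" using b by (simp add: N_def)
  have C: "C > 0" using b by (simp add: C_def)
  have \<delta>: "\<delta> > 0" using False fD N by (simp add: \<delta>_def card_gt_0_iff)
  define g where "g B = of_bool (B \<in> \<D>) - \<delta>" for B
  have cN: "real (card (subsets_of_size V b)) = N" using V by (simp add: N_def card_subsets_of_size)
  have sD: "(\<Sum>B\<in>subsets_of_size V b. of_bool (B \<in> \<D>)) = real (card \<D>)"
    using fS D by (simp add: of_bool_def sum.If_cases Int_absorb1)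
  have g0: "(\<Sum>B\<in>subsets_of_size V b. g B) = 0" using sD cN N by (simp add: g_def sum_subtractf \<delta>_def)
  have gg: "(\<Sum>B\<in>subsets_of_size V b. (g B)\<^sup>2) = \<delta> * (N - real (card \<D>))"
  proof -
    have "(g B)\<^sup>2 = (1 - 2 * \<delta>) * of_bool (B \<in> \<D>) + \<delta>\<^sup>2" for B
      by (simp add: g_def power2_eq_square algebra_simps)
    then have sum: "(\<Sum>B\<in>subsets_of_size V b. (g B)\<^sup>2) = (1 - 2 * \<delta>) * real (card \<D>) + N * \<delta>\<^sup>2"
      using sD cN by (simp add: sum.distrib sum_distrib_left[symmetric])
    have cD: "real (card \<D>) = \<delta> * N" using N by (simp add: \<delta>_def)
    show ?thesis unfolding sum cD by (simp add: algebra_simps power2_eq_square)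
  qed
  have T: "(\<Sum>B\<in>subsets_of_size (V - A) b. g B) = - (\<delta> * C)" if A: "A \<in> \<W>" for A
  proof -
    have AS: "A \<in> subsets_of_size V (Suc b)" using A W by blast
    have "B \<notin> \<D>" if "B \<in> subsets_of_size (V - A) b" for B
    proof
      assume "B \<in> \<D>"
      then have "1 \<le> card (A \<inter> B)" using cr A by (auto simp: cross_def)
      moreover have "A \<inter> B = {}" using that by (auto simp: subsets_of_size_def)
      ultimately show False by simp
    qed
    then have "(\<Sum>B\<in>subsets_of_size (V - A) b. g B) = (\<Sum>B\<in>subsets_of_size (V - A) b. - \<delta>)" by (intro sum.cong) (auto simp: g_def)
    moreover have "card (V - A) = card V - b - 1" using AS V finite_subsets_mem[OF V AS] by (auto simp: subsets_of_size_def card_Diff_subset)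
    ultimately show ?thesis using V by (simp add: card_subsets_of_size C_def)
  qed
  have "real (card \<W>) * (\<delta> * C)\<^sup>2 = (\<Sum>A\<in>\<W>. (\<Sum>B\<in>subsets_of_size (V - A) b. g B)\<^sup>2)" using T by simp
  also have "\<dots> \<le> (\<Sum>A\<in>subsets_of_size V (Suc b). (\<Sum>B\<in>subsets_of_size (V - A) b. g B)\<^sup>2)"
    by (rule sum_mono2[OF fS W]) auto
  also have "\<dots> \<le> real (card V - b - 2 choose (b - 1)) * real (card V - b - 1 choose b) * (\<Sum>B\<in>subsets_of_size V b. (g B)\<^sup>2)"
    by (rule disjointness_spectral_bound) (use V b g0 in auto)
  finally have 1: "real (card \<W>) * (\<delta> * C)\<^sup>2 \<le> real (card V - b - 2 choose (b - 1)) * C * (\<delta> * (N - real (card \<D>)))"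
    unfolding gg C_def .
  have 2: "real (card V - b - 1) * real (card V - b - 2 choose (b - 1)) = real b * C"
  proof -
    have "b * (card V - b - 1 choose b) = (card V - b - 1) * (card V - b - 1 - 1 choose (b - 1))"
      by (rule times_binomial_minus1_eq) (use b in simp)
    then have "real (b * (card V - b - 1 choose b)) = real ((card V - b - 1) * (card V - b - 2 choose (b - 1)))" by (simp add: numeral_2_eq_2)
    then show ?thesis by (simp only: of_nat_mult C_def)
  qed
  have "real (card V - b - 1) * (real (card \<W>) * (\<delta> * C)\<^sup>2)
    \<le> real (card V - b - 1) * (real (card V - b - 2 choose (b - 1)) * C * (\<delta> * (N - real (card \<D>))))"
    by (rule mult_left_mono[OF 1]) simp
  also have "\<dots> = (real b * C) * C * (\<delta> * (N - real (card \<D>)))" unfolding 2[symmetric] by (simp add: mult_ac)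
  finally have "(\<delta> * C\<^sup>2) * (real (card \<W>) * \<delta> * real (card V - b - 1)) \<le> (\<delta> * C\<^sup>2) * (real b * (N - real (card \<D>)))"
    by (simp add: power2_eq_square mult_ac)
  moreover have "\<delta> * C\<^sup>2 > 0" using \<delta> C by simp
  ultimately have "real (card \<W>) * \<delta> * real (card V - b - 1) \<le> real b * (N - real (card \<D>))"
    by (simp only: mult_le_cancel_left_pos)
  then have "N * (real (card \<W>) * \<delta> * real (card V - b - 1)) \<le> N * (real b * (N - real (card \<D>)))"
    using N by (intro mult_left_mono) auto
  moreover have "N * (real (card \<W>) * \<delta> * real (card V - b - 1)) = real (card \<W>) * real (card \<D>) * real (card V - b - 1)"
    using N by (simp add: \<delta>_def)
  ultimately have "real (card \<W>) * real (card \<D>) * real (card V - b - 1) \<le> N * (real b * (N - real (card \<D>)))" by (simp only:)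
  then show ?thesis by (simp add: N_def mult_ac)
qed

subsection \<open>Diversity\<close>

text \<open>The ratio of \<open>card V - b - 1\<close> to \<open>b\<close> is at least 35, and 35 *
  0.89 > 31.\<close>

lemma cross_spectral_31:
  assumes V: "finite V" and W: "\<W> \<subseteq> subsets_of_size V (Suc b)" and D: "\<D> \<subseteq> subsets_of_size V b" and cr: "cross 1 \<W> \<D>"
    and b: "b \<ge> 1" "35 * b \<le> card V - b - 1" and d: "89 / 100 * real (card V choose b) \<le> real (card \<D>)"
  shows "31 * real (card \<W>) \<le> real (card V choose b) - real (card \<D>)"
proof -
  define N w d' where "N = real (card V choose b)" and "w = real (card \<W>)" and "d' = real (card \<D>)"
  have b2: "2 * b + 1 \<le> card V" using b by linarith
  then have N: "N > 0" by (simp add: N_def)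
  have w: "w \<ge> 0" "d' \<ge> 0" by (auto simp: w_def d'_def)
  have "w * d' * (35 * real b) \<le> w * d' * real (card V - b - 1)"
    using b(2) w by (intro mult_left_mono) auto
  also have "\<dots> \<le> real b * (N - d') * N"
    unfolding w_def d'_def N_def by (rule cross_spectral[OF V W D cr b(1) b2])
  finally have "real b * (35 * w * d') \<le> real b * ((N - d') * N)" by (simp add: mult_ac)
  then have 1: "35 * w * d' \<le> (N - d') * N" using b(1) by simp
  have "N * (31 * w) \<le> 35 * w * (89 / 100 * N)" using w N by (simp add: mult_ac)
  also have "\<dots> \<le> 35 * w * d'" using d w unfolding N_def d'_def by (intro mult_left_mono) auto
  also note 1
  finally have "N * (31 * w) \<le> N * (N - d')" by (simp add: mult_ac)
  then show ?thesis using N unfolding N_def w_def d'_def by simp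
qed

lemma (in ground) low_avoidance:
  assumes big: "36 * k < card X" and fam: "fam \<F>"
  shows "\<exists>x\<in>X. cnt \<F> (\<lambda>F. x \<notin> F) \<le> real (card X - 3 choose (k - 2))"
proof (rule ccontr)
  define n where "n = card X"
  define N where "N = real (n - 3 choose (k - 2))"
  assume "\<not> ?thesis"
  then have avoid: "N < cnt \<F> (\<lambda>F. x \<notin> F)" if "x \<in> X" for x using that by (auto simp: N_def n_def not_le)
  have finF: "finite \<F>" using fam fam_finite by blast
  have n: "36 * k < n" using big by (simp add: n_def)
  have Mn: "M = real (n - 3 choose (k - 3))" by (simp add: M_def n_def)
  have NM: "35 * M \<le> N"
  proof -
    have "(k - 2) * (n - 3 choose (k - 2)) = (n - k) * (n - 3 choose (k - 3))"
    proof -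
      have s: "k - 2 = Suc (k - 3)" "n - k = n - 3 - (k - 3)" using k3 by auto
      show ?thesis unfolding s using binomial_absorption[of "k - 3" "n - 3"] binomial_absorb_comp[of "n - 3" "k - 3"] by simp
    qed
    then have e: "real (k - 2) * N = real (n - k) * M" unfolding N_def Mn by (metis of_nat_mult)
    have "real (k - 2) * (35 * M) \<le> real (n - k) * M"
    proof -
      have "35 * (k - 2) \<le> n - k" using n by linarith
      then have "35 * real (k - 2) \<le> real (n - k)" by linarith
      from mult_right_mono[OF this, of M] M_pos show ?thesis by (simp add: mult_ac)
    qed
    then have "real (k - 2) * (35 * M) \<le> real (k - 2) * N" using e by simp
    then show ?thesis using k3 by simp
  qed
  have Xne: "X \<noteq> {}" using n by (auto simp: n_def)
  obtain x where x: "x \<in> X" and xmax: "\<And>y. y \<in> X \<Longrightarrow> cnt \<F> (\<lambda>F. y \<in> F) \<le> cnt \<F> (\<lambda>F. x \<in> F)"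
  proof -
    let ?d = "\<lambda>y. cnt \<F> (\<lambda>F. y \<in> F)"
    have "Max (?d ` X) \<in> ?d ` X" using finX Xne by (intro Max_in) auto
    then obtain x where x: "Max (?d ` X) = ?d x" "x \<in> X" by (rule imageE)
    have "?d y \<le> ?d x" if "y \<in> X" for y unfolding x(1)[symmetric] using finX that by (intro Max_ge) auto
    then show thesis using x(2) by (rule that[rotated])
  qed
  obtain y where y: "y \<in> X" "y \<noteq> x" and B: "N < 2 * cnt \<F> (\<lambda>F. y \<in> F \<and> x \<notin> F)"
  proof -
    interpret Y: ground "X - {x}" k
      using finX x n k3 by unfold_locales (auto simp: n_def)
    let ?G = "{F \<in> \<F>. x \<notin> F}"
    have fG: "Y.fam ?G" using fam by (auto simp: subsets_of_size_def intersecting_def)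
    have cG: "real (card ?G) = cnt \<F> (\<lambda>F. x \<notin> F)" using finF by (simp add: cnt_eq_card)
    have "Y.M \<le> M" unfolding Y.M_def M_def by (auto intro!: binomial_right_mono diff_le_mono card_mono finX)
    then have "35 * Y.M \<le> real (card ?G)" using NM avoid[OF x] cG by linarith
    from Y.degree_more_than_half[OF fG this] obtain y where y: "y \<in> X - {x}" "real (card ?G) < 2 * cnt ?G (\<lambda>F. y \<in> F)" by blast
    have "cnt ?G (\<lambda>F. y \<in> F) = cnt \<F> (\<lambda>F. y \<in> F \<and> x \<notin> F)"
    proof -
      have "{F \<in> ?G. y \<in> F} = {F \<in> \<F>. y \<in> F \<and> x \<notin> F}" by auto
      then show ?thesis using finF by (simp add: cnt_eq_card)
    qed
    then show thesis using that[of y] y avoid[OF x] cG by auto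
  qed
  let ?A = "{F \<in> \<F>. x \<in> F \<and> y \<notin> F}" and ?B = "{F \<in> \<F>. y \<in> F \<and> x \<notin> F}"
  have cA: "real (card ?A) = cnt \<F> (\<lambda>F. x \<in> F \<and> y \<notin> F)" and cB: "real (card ?B) = cnt \<F> (\<lambda>F. y \<in> F \<and> x \<notin> F)"
    using finF by (simp_all add: cnt_eq_card)
  have AB: "card ?B \<le> card ?A"
  proof -
    have "cnt \<F> (\<lambda>F. x \<in> F) = cnt \<F> (\<lambda>F. x \<in> F \<and> y \<notin> F) + cnt \<F> (\<lambda>F. x \<in> F \<and> y \<in> F)"
      "cnt \<F> (\<lambda>F. y \<in> F) = cnt \<F> (\<lambda>F. y \<in> F \<and> x \<notin> F) + cnt \<F> (\<lambda>F. x \<in> F \<and> y \<in> F)"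
      unfolding cnt_def sum.distrib[symmetric] by (auto intro!: sum.cong)
    then have "real (card ?B) \<le> real (card ?A)" using xmax[OF y(1)] cA cB by linarith
    then show ?thesis by simp
  qed
  \<comment> \<open>Cutting down to equal sizes gives \<open>x\<close> and \<open>y\<close> exactly
    half of \<open>?H\<close>, so the majority element is a third one.\<close>
  obtain \<A> where A: "\<A> \<subseteq> ?A" "card \<A> = card ?B" using obtain_subset_with_card_n[OF AB] by blast
  let ?H = "\<A> \<union> ?B"
  have fH: "fam ?H" using fam A by (auto simp: intersecting_def)
  have finA: "finite \<A>" using A finF by (auto intro: finite_subset)
  have cH: "card ?H = 2 * card ?B" using A finA finF by (subst card_Un_disjoint) auto
  have "35 * M \<le> real (card ?H)" using NM B cB cH by simp
  from degree_more_than_half[OF fH this] obtain z where z: "z \<in> X" "real (card ?B) < cnt ?H (\<lambda>F. z \<in> F)"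
    using cH by auto
  have finH: "finite ?H" using finA finF by simp
  have "cnt ?H (\<lambda>F. x \<in> F) = real (card ?B)"
  proof -
    have "{F \<in> ?H. x \<in> F} = \<A>" using A by auto
    then show ?thesis using A(2) unfolding cnt_eq_card[OF finH] by simp
  qed
  moreover have "cnt ?H (\<lambda>F. y \<in> F) = real (card ?B)"
  proof -
    have "{F \<in> ?H. y \<in> F} = ?B" using A by auto
    then show ?thesis unfolding cnt_eq_card[OF finH] by simp
  qed
  ultimately have zxy: "z \<noteq> x" "z \<noteq> y" using z by auto
  let ?U = "{x, y, z}"
  let ?n = "\<lambda>S. cnt \<F> (\<lambda>F. F \<inter> ?U = S)"
  have U: "?U \<subseteq> X" "card ?U = 3" using x y z zxy by auto
  have "cnt ?H (\<lambda>F. z \<in> F) \<le> cnt \<F> (\<lambda>F. z \<in> F \<and> (x \<in> F \<and> y \<notin> F \<or> y \<in> F \<and> x \<notin> F))"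
    unfolding cnt_eq_card[OF finH] cnt_eq_card[OF finF] of_nat_le_iff
    by (rule card_mono) (use finF A in auto)
  also have "\<dots> \<le> ?n {x, z} + ?n {y, z}"
    using cnt_le_sum_list[of \<F> "\<lambda>F. z \<in> F \<and> (x \<in> F \<and> y \<notin> F \<or> y \<in> F \<and> x \<notin> F)" "[\<lambda>F. F \<inter> ?U = {x, z}, \<lambda>F. F \<inter> ?U = {y, z}]"]
    by force
  finally have xzyz: "real (card ?B) < ?n {x, z} + ?n {y, z}" using z by linarith
  have cBle: "real (card ?B) \<le> ?n {y} + ?n {y, z}"
    using cnt_le_sum_list[of \<F> "\<lambda>F. y \<in> F \<and> x \<notin> F" "[\<lambda>F. F \<inter> ?U = {y}, \<lambda>F. F \<inter> ?U = {y, z}]"] cB by force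
  have cAle: "real (card ?B) \<le> ?n {x} + ?n {x, z}"
    using cnt_le_sum_list[of \<F> "\<lambda>F. x \<in> F \<and> y \<notin> F" "[\<lambda>F. F \<inter> ?U = {x}, \<lambda>F. F \<inter> ?U = {x, z}]"] cA AB by force
  have L: "?n S \<le> 11 / 5 * M \<or> ?n S' \<le> 6 / 5 * M" if "S \<inter> S' = {}" "card S = 2" "card S' \<le> 1" for S S'
    unfolding M_def by (rule link_2_bound[OF finX cardX k3 _ _ U(1)]) (use fam U that in auto)
  have L1: "?n {x, z} \<le> 11 / 5 * M \<or> ?n {y} \<le> 6 / 5 * M" "?n {y, z} \<le> 11 / 5 * M \<or> ?n {x} \<le> 6 / 5 * M"
    "?n {x, z} \<le> 11 / 5 * M \<or> ?n {} \<le> 6 / 5 * M" "?n {x, y} \<le> 11 / 5 * M \<or> ?n {z} \<le> 6 / 5 * M"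
    by (rule L; use zxy y in auto)+
  have Bbig: "35 / 2 * M < real (card ?B)" using B cB NM by linarith
  \<comment> \<open>If \<open>{y}\<close> were frequent, \<open>{x, z}\<close> would be rare, hence
    \<open>{y, z}\<close> frequent by \<open>xzyz\<close> and \<open>{x}\<close> rare; but
    \<open>{x}\<close> and \<open>{x, z}\<close> together cover at least \<open>card ?B\<close>. The
    other two claims are similar.\<close>
  have small: "?n {x} \<le> 6 / 5 * M" "?n {y} \<le> 6 / 5 * M" "?n {} \<le> 6 / 5 * M"
    using L1 Bbig xzyz cBle cAle M_pos by linarith+
  have Av: "N < ?n {y, z} + (?n {y} + (?n {z} + ?n {}))" "N < ?n {x, z} + (?n {x} + (?n {z} + ?n {}))"
    "N < ?n {x, y} + (?n {x} + (?n {y} + ?n {}))"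
  proof -
    have "cnt \<F> (\<lambda>F. x \<notin> F) \<le> ?n {y, z} + (?n {y} + (?n {z} + ?n {}))"
      using cnt_le_sum_list[of \<F> "\<lambda>F. x \<notin> F" "[\<lambda>F. F \<inter> ?U = {y, z}, \<lambda>F. F \<inter> ?U = {y}, \<lambda>F. F \<inter> ?U = {z}, \<lambda>F. F \<inter> ?U = {}]"] by force
    then show "N < ?n {y, z} + (?n {y} + (?n {z} + ?n {}))" using avoid[OF x] by linarith
    have "cnt \<F> (\<lambda>F. y \<notin> F) \<le> ?n {x, z} + (?n {x} + (?n {z} + ?n {}))"
      using cnt_le_sum_list[of \<F> "\<lambda>F. y \<notin> F" "[\<lambda>F. F \<inter> ?U = {x, z}, \<lambda>F. F \<inter> ?U = {x}, \<lambda>F. F \<inter> ?U = {z}, \<lambda>F. F \<inter> ?U = {}]"] by force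
    then show "N < ?n {x, z} + (?n {x} + (?n {z} + ?n {}))" using avoid[OF y(1)] by linarith
    have "cnt \<F> (\<lambda>F. z \<notin> F) \<le> ?n {x, y} + (?n {x} + (?n {y} + ?n {}))"
      using cnt_le_sum_list[of \<F> "\<lambda>F. z \<notin> F" "[\<lambda>F. F \<inter> ?U = {x, y}, \<lambda>F. F \<inter> ?U = {x}, \<lambda>F. F \<inter> ?U = {y}, \<lambda>F. F \<inter> ?U = {}]"] by force
    then show "N < ?n {x, y} + (?n {x} + (?n {y} + ?n {}))" using avoid[OF z(1)] by linarith
  qed
  have nz: "?n {z} \<le> 6 / 5 * M" using L1(4) Av(3) small NM M_pos by linarith
  have large: "N - 18 / 5 * M \<le> ?n {y, z}" "N - 18 / 5 * M \<le> ?n {x, z}" "N - 18 / 5 * M \<le> ?n {x, y}"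
    using Av small nz by linarith+
  have bk: "Suc (k - 2) = k - 1" using k3 by simp
  have cV: "card (X - ?U) = n - 3" using U finX by (simp add: card_Diff_subset n_def)
  have finm: "finite F" if "F \<in> \<F>" for F using fam fam_mem that by blast
  have spec: "31 * ?n {c} \<le> N - ?n {a, b}"
    if "a \<noteq> b" "c \<noteq> a" "c \<noteq> b" "N - 18 / 5 * M \<le> ?n {a, b}" for a b c
  proof -
    have "31 * real (card (link ?U {c} \<F>)) \<le> real (card (X - ?U) choose (k - 2)) - real (card (link ?U {a, b} \<F>))"
    proof (rule cross_spectral_31)
      show "link ?U {c} \<F> \<subseteq> subsets_of_size (X - ?U) (Suc (k - 2))" using link_subset[OF finX, of \<F> k ?U "{c}"] fam bk by simp
      show "link ?U {a, b} \<F> \<subseteq> subsets_of_size (X - ?U) (k - 2)" using link_subset[OF finX, of \<F> k ?U "{a, b}"] fam that by (simp add: numeral_2_eq_2)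
      show "cross 1 (link ?U {c} \<F>) (link ?U {a, b} \<F>)" using fam that finm by (intro cross_1_link) auto
      show "89 / 100 * real (card (X - ?U) choose (k - 2)) \<le> real (card (link ?U {a, b} \<F>))"
        unfolding card_link[OF finF] cV using that(4) NM M_pos unfolding N_def[symmetric] by linarith
      show "finite (X - ?U)" using finX by simp
      show "1 \<le> k - 2" using k3 by linarith
      show "35 * (k - 2) \<le> card (X - ?U) - (k - 2) - 1" unfolding cV using n k3 by linarith
    qed
    then show ?thesis unfolding card_link[OF finF] cV N_def by simp
  qed
  have w: "31 * ?n {x} \<le> N - ?n {y, z}" "31 * ?n {y} \<le> N - ?n {x, z}" "31 * ?n {z} \<le> N - ?n {x, y}"
    by (rule spec; use zxy y large in auto)+
  \<comment> \<open>The links over \<open>{}\<close> and \<open>{x, y}\<close> differ by two in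
    size, while the spectral bound wants a difference of one. So the family is shifted outside the
    triangle: more than half of the members missing it, if any, then contain the smallest
    \<open>v\<close>, and the trace \<open>{v}\<close> takes the place of \<open>{}\<close>, which
    costs the factor 2.\<close>
  have w0: "31 * ?n {} \<le> 2 * (N - ?n {x, y})"
  proof -
    obtain \<G> where G: "\<G> \<subseteq> subsets_of_size X k" "intersecting \<G>" "shifted_on (X - ?U) \<G>"
      and eq: "\<And>P. cnt \<G> (\<lambda>F. P (F \<inter> ?U)) = cnt \<F> (\<lambda>F. P (F \<inter> ?U))"
      using shift_outside[OF finX, of \<F> k ?U] fam by blast
    have finG: "finite \<G>" and finm: "\<And>F. F \<in> \<G> \<Longrightarrow> finite F \<and> F \<subseteq> X" using fam_finite fam_mem G by blast+
    let ?V = "X - ?U"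
    have "card ?V \<noteq> 0" using cV n k3 by linarith
    then have "?V \<noteq> {}" by (metis card.empty)
    define v where "v = Min ?V"
    have v: "v \<in> ?V" "\<And>w. w \<in> ?V \<Longrightarrow> v \<le> w" using finX \<open>?V \<noteq> {}\<close>
      unfolding v_def by (meson Min_in finite_Diff, meson Min_le finite_Diff)
    let ?W = "{x, y, z, v}"
    let ?m = "\<lambda>S. cnt \<G> (\<lambda>F. F \<inter> ?W = S)"
    have cW: "card (X - ?W) = n - 4"
    proof -
      have "?W \<subseteq> X" "card ?W = 4" using U v zxy y by auto
      then show ?thesis using finX by (simp add: card_Diff_subset n_def)
    qed
    let ?C = "{F \<in> \<G>. F \<inter> ?U = {}}"
    have "real (card ?C) \<le> 2 * ?m {v}"
    proof (cases "?C = {}")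
      case True
      then have "card ?C = 0" by (simp only: card.empty)
      then show ?thesis using cnt_nonneg[of \<G>] by simp
    next
      case False
      have "card ?C < 2 * card {F \<in> ?C. v \<in> F}"
      proof (rule shifted_min_majority[OF _ _ False _ _ v])
        show "finite ?V" using finX by simp
        show "?C \<subseteq> Pow ?V" using finm by blast
        show "shifted_on ?V ?C" unfolding shifted_on_def
        proof (intro ballI impI)
          fix F i j assume F: "F \<in> ?C" "i \<in> ?V" "j \<in> ?V" "i < j \<and> j \<in> F \<and> i \<notin> F"
          then have "insert i (F - {j}) \<in> \<G>" using G(3) unfolding shifted_on_def by blast
          then show "insert i (F - {j}) \<in> ?C" using F by blast
        qed
        show "intersecting ?C" using G(2) unfolding intersecting_def by blast
      qed
      moreover have "F \<inter> ?U = {} \<and> v \<in> F \<longleftrightarrow> F \<inter> ?W = {v}" for F using v(1) by auto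
      then have "{F \<in> ?C. v \<in> F} = {F \<in> \<G>. F \<inter> ?W = {v}}" by blast
      ultimately have "card ?C < 2 * card {F \<in> \<G>. F \<inter> ?W = {v}}" by (simp only:)
      then show ?thesis unfolding cnt_eq_card[OF finG] by linarith
    qed
    then have 1: "?n {} \<le> 2 * ?m {v}" using eq[of "\<lambda>S. S = {}"] cnt_eq_card[OF finG, of "\<lambda>F. F \<inter> ?U = {}"] by linarith
    have "F \<inter> ?W = {x, y} \<or> F \<inter> ?W = {x, y, v}" if "F \<inter> ?U = {x, y}" for F
    proof -
      have "F \<inter> ?W = F \<inter> ?U \<union> F \<inter> {v}" by auto
      then show ?thesis unfolding that by (cases "v \<in> F") auto
    qed
    then have "cnt \<G> (\<lambda>F. F \<inter> ?U = {x, y}) \<le> ?m {x, y} + ?m {x, y, v}"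
      using cnt_le_sum_list[of \<G> "\<lambda>F. F \<inter> ?U = {x, y}" "[\<lambda>F. F \<inter> ?W = {x, y}, \<lambda>F. F \<inter> ?W = {x, y, v}]"] by simp
    then have "?n {x, y} \<le> ?m {x, y} + ?m {x, y, v}" using eq[of "\<lambda>S. S = {x, y}"] by linarith
    moreover have "?m {x, y, v} \<le> real (n - 4 choose (k - 3))"
    proof -
      have "link ?W {x, y, v} \<G> \<subseteq> subsets_of_size (X - ?W) (k - 3)"
        using link_subset[OF finX G(1), of ?W "{x, y, v}"] v y by (simp add: numeral_3_eq_3)
      then have "card (link ?W {x, y, v} \<G>) \<le> card (subsets_of_size (X - ?W) (k - 3))"
        by (rule card_mono[rotated]) (use finite_subsets_of_size finX in auto)
      then have "real (card (link ?W {x, y, v} \<G>)) \<le> real (n - 4 choose (k - 3))"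
        using finX cW by (simp add: card_subsets_of_size)
      then show ?thesis unfolding card_link[OF finG] .
    qed
    moreover have Npas: "N = real (n - 4 choose (k - 2)) + real (n - 4 choose (k - 3))"
    proof -
      have e: "n - 3 = Suc (n - 4)" "k - 2 = Suc (k - 3)" using n k3 by auto
      have "(n - 3 choose (k - 2)) = (n - 4 choose (k - 3)) + (n - 4 choose (k - 2))"
        unfolding e by (rule binomial_Suc_Suc)
      then show ?thesis unfolding N_def by simp
    qed
    moreover have "real (n - 4 choose (k - 3)) \<le> M" unfolding Mn by (auto intro!: binomial_right_mono)
    \<comment> \<open>Pascal's rule splits \<open>N\<close> according to \<open>v\<close>. The part
      through \<open>v\<close> is at least the number of members with trace
      \<open>{x, y, v}\<close>, so excluding \<open>v\<close> does not increase the number of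
      missing sets.\<close>
    ultimately have d1: "real (n - 4 choose (k - 2)) - ?m {x, y} \<le> N - ?n {x, y}"
      and d2: "34 * M \<le> real (n - 4 choose (k - 2))" using NM by linarith+
    have "31 * real (card (link ?W {v} \<G>)) \<le> real (card (X - ?W) choose (k - 2)) - real (card (link ?W {x, y} \<G>))"
    proof (rule cross_spectral_31)
      show "link ?W {v} \<G> \<subseteq> subsets_of_size (X - ?W) (Suc (k - 2))" using link_subset[OF finX G(1), of ?W "{v}"] bk by simp
      show "link ?W {x, y} \<G> \<subseteq> subsets_of_size (X - ?W) (k - 2)" using link_subset[OF finX G(1), of ?W "{x, y}"] y by (simp add: numeral_2_eq_2)
      show "cross 1 (link ?W {v} \<G>) (link ?W {x, y} \<G>)" using G v finm by (intro cross_1_link) auto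
      show "89 / 100 * real (card (X - ?W) choose (k - 2)) \<le> real (card (link ?W {x, y} \<G>))"
        unfolding card_link[OF finG] cW using d1 d2 large(3) M_pos by linarith
      show "finite (X - ?W)" using finX by simp
      show "1 \<le> k - 2" using k3 by linarith
      show "35 * (k - 2) \<le> card (X - ?W) - (k - 2) - 1" unfolding cW using n k3 by linarith
    qed
    then have "31 * ?m {v} \<le> real (n - 4 choose (k - 2)) - ?m {x, y}" unfolding card_link[OF finG] cW .
    moreover have "31 * a \<le> 2 * e" if "31 * b \<le> c" "a \<le> 2 * b" "c \<le> e" for a b c e :: real using that by linarith
    ultimately show ?thesis using 1 d1 by blast
  qed
  \<comment> \<open>\<open>L - dx\<close>, \<open>L - dy\<close> and \<open>L - dz\<close> count the
    sets missing over the three pairs. Adding the avoidance inequalities bounds their total by 2 (wx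
    + wy + wz) + 3 e, while each exceptional member is paid for by at least 31 / 2 missing
    sets.\<close>
  have False if "L < dx + (wy + (wz + e))" "L < dy + (wx + (wz + e))" "L < dz + (wx + (wy + e))"
    "31 * wx \<le> L - dx" "31 * wy \<le> L - dy" "31 * wz \<le> L - dz" "31 * e \<le> 2 * (L - dz)"
    "0 \<le> wx" "0 \<le> wy" "0 \<le> wz" for L dx dy dz wx wy wz e :: real
  proof -
    define a b c where "a = L - dx" and "b = L - dy" and "c = L - dz"
    have "a \<ge> 0" "b \<ge> 0" using that by (auto simp: a_def b_def)
    moreover have "a + b + c < 2 * (wx + wy + wz) + 3 * e" using that(1-3) unfolding a_def b_def c_def by argo
    moreover have "31 * (2 * (wx + wy + wz) + 3 * e) \<le> 2 * (a + b + c) + 6 * c" using that(4-7) unfolding a_def b_def c_def by argo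
    ultimately show False using that(6,10) unfolding c_def[symmetric] by argo
  qed
  from this[OF Av w w0 cnt_nonneg cnt_nonneg cnt_nonneg] show False .
qed

section \<open>Small \<open>k\<close> and the passage to the integer binomial\<close>

lemma diversity_le: "i \<in> {1..n} \<Longrightarrow> diversity n \<F> \<le> card (avoiding \<F> i)"
  unfolding diversity_def by (rule Min_le) auto

theorem theorem1p6:
  fixes n k :: nat and \<F> :: "nat set set"
  assumes "n > 0" and "k > 0" and "n > 36 * k"
    and "\<F> \<subseteq> k_subsets n k"
    and "intersecting \<F>"
  shows "diversity n \<F> \<le> int_binom (int n - 3) (int k - 2)"
proof -
  have mem: "F \<subseteq> {1..n} \<and> card F = k" if "F \<in> \<F>" for F using assms(4) that by (auto simp: k_subsets_def)
  have meet: "F \<inter> G \<noteq> {}" if "F \<in> \<F>" "G \<in> \<F>" for F G using assms(5) that by (auto simp: intersecting_def)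
  have one: "1 \<in> {1..n}" using assms(1) by auto
  show ?thesis
  proof (cases "\<F> = {}")
    case True
    then have "avoiding \<F> 1 = {}" by (simp add: avoiding_def)
    then show ?thesis using diversity_le[OF one, of \<F>] by simp
  next
    case False
    \<comment> \<open>For k < 3 the binomial \<open>M\<close> loses its meaning; the bound is 0 for
      k = 1 and 1 for k = 2.\<close>
    consider "k = 1" | "k = 2" | "k \<ge> 3" using assms(2) by linarith
    then show ?thesis
    proof cases
      case 1
      obtain F where F: "F \<in> \<F>" using False by blast
      then obtain a where a: "F = {a}" using mem[of F] 1 by (auto simp: card_1_singleton_iff)
      then have "a \<in> {1..n}" using mem[OF F] a by auto
      moreover have "avoiding \<F> a = {}" using meet[OF F] a by (auto simp: avoiding_def)
      ultimately show ?thesis using diversity_le[of a n \<F>] by simp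
    next
      case 2
      obtain F where F: "F \<in> \<F>" using False by blast
      then obtain a b where ab: "F = {a, b}" "a \<noteq> b" using mem[of F] 2 by (auto simp: card_2_iff)
      \<comment> \<open>Pairwise meeting edges form a star or a triangle.\<close>
      have "\<exists>i\<in>{1..n}. card (avoiding \<F> i) \<le> 1"
      proof (cases "\<forall>G\<in>\<F>. a \<in> G")
        case True
        then have "avoiding \<F> a = {}" by (auto simp: avoiding_def)
        moreover have "a \<in> {1..n}" using mem[OF F] ab by auto
        ultimately show ?thesis by (intro bexI[of _ a]) auto
      next
        case False
        then obtain G where G: "G \<in> \<F>" "a \<notin> G" by blast
        then have "b \<in> G" using meet[OF F, of G] ab by auto
        moreover obtain g h where "G = {g, h}" "g \<noteq> h" using mem[of G] G 2 by (auto simp: card_2_iff)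
        ultimately obtain c where c: "G = {b, c}" "b \<noteq> c" by blast
        have "avoiding \<F> b \<subseteq> {{a, c}}"
        proof
          fix H assume "H \<in> avoiding \<F> b"
          then have H: "H \<in> \<F>" "b \<notin> H" by (auto simp: avoiding_def)
          have "a \<in> H" "c \<in> H" using meet[OF H(1) F] meet[OF H(1) G(1)] ab c H by auto
          moreover have "a \<noteq> c" using G c by auto
          moreover obtain g h where "H = {g, h}" "g \<noteq> h" using mem[of H] H 2 by (auto simp: card_2_iff)
          ultimately show "H \<in> {{a, c}}" by auto
        qed
        then have "card (avoiding \<F> b) \<le> card {{a, c}}" by (rule card_mono[rotated]) simp
        then show ?thesis using mem[OF F] ab by (intro bexI[of _ b]) auto
      qed
      then show ?thesis using diversity_le[of _ n \<F>] 2 assms(3) by (force simp: int_binom_def)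
    next
      case 3
      interpret ground "{1..n}" k using 3 assms(3) by unfold_locales auto
      have fam: "fam \<F>" using mem assms(5) by (auto simp: subsets_of_size_def)
      obtain x where x: "x \<in> {1..n}" "cnt \<F> (\<lambda>F. x \<notin> F) \<le> real (n - 3 choose (k - 2))"
        using low_avoidance[OF _ fam] assms(3) by auto
      have "card (avoiding \<F> x) \<le> (n - 3 choose (k - 2))"
        using x(2) fam_finite[OF fam] by (simp add: cnt_eq_card avoiding_def)
      moreover have "int_binom (int n - 3) (int k - 2) = (n - 3 choose (k - 2))"
        using 3 assms(3) by (auto simp: int_binom_def nat_diff_distrib' intro!: arg_cong2[where f = binomial])
      ultimately show ?thesis using diversity_le[OF x(1), of \<F>] by simp
    qed
  qed
qed

end
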